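(* Let $a_n>0$, $b_n\in\mathbb{R}$ be the parameters of a Jacobi matrix $J$ such that the limits $$\lim_{n\to\infty}n(a_n-1)=\alpha,\qquad \lim_{n\to\infty}nb_n=\beta$$ exist and are finite. Suppose that $|\beta|>2\alpha$. Then $Z(J)=\infty$.
   Context: The Jacobi matrix $J$ with parameters $a_n>0$, $b_n\in\mathbb{R}$ ($n\ge1$, bounded) is the bounded self-adjoint operator on $\ell^2(\mathbb{Z}^+)$, $\mathbb{Z}^+=\{1,2,\dots\}$, given by the tridiagonal matrix with $J_{n,n}=b_n$, $J_{n,n+1}=J_{n+1,n}=a_n$. Let $\nu$ be the spectral measure of $J$ for the vector $\delta_1$, and $d\nu_{\mathrm{ac}}/dE$ the density of its absolutely continuous part. The Szegő integral is $$Z(J)=\frac1{2\pi}\int_{-2}^2\ln\left(\frac{\sqrt{4-E^2}}{2\pi\, d\nu_{\mathrm{ac}}/dE}\right)\frac{dE}{\sqrt{4-E^2}}\in(-\infty,+\infty].$$ *)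

theory Defs
  imports "HOL-Analysis.Analysis" "HOL-Computational_Algebra.Polynomial"
begin

section \<open>Square-summable sequences over the positive integers\<close>

text \<open>
  A sequence \<open>(u\<^sub>1, u\<^sub>2, \<dots>)\<close> is a function on \<^typ>\<open>nat\<close> vanishing at \<open>0\<close>. Operators are
  functions on sequences, of which only the values on \<open>ell2\<close> matter.
\<close>

definition ell2 :: "(nat \<Rightarrow> complex) set" where
  "ell2 = {u. u 0 = 0 \<and> summable (\<lambda>n. (cmod (u n))\<^sup>2)}"

definition ell2_norm :: "(nat \<Rightarrow> complex) \<Rightarrow> real" where
  "ell2_norm u = sqrt (\<Sum>n. (cmod (u n))\<^sup>2)"

definition ell2_inner :: "(nat \<Rightarrow> complex) \<Rightarrow> (nat \<Rightarrow> complex) \<Rightarrow> complex" where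
  "ell2_inner u v = (\<Sum>n. cnj (u n) * v n)"

definition delta :: "nat \<Rightarrow> nat \<Rightarrow> complex" where
  "delta k = (\<lambda>n. if n = k then 1 else 0)"

type_synonym seq_op = "(nat \<Rightarrow> complex) \<Rightarrow> (nat \<Rightarrow> complex)"

definition bounded_op :: "seq_op \<Rightarrow> bool" where
  "bounded_op A \<longleftrightarrow>
     (\<forall>u\<in>ell2. A u \<in> ell2) \<and>
     (\<forall>u\<in>ell2. \<forall>v\<in>ell2. A (\<lambda>n. u n + v n) = (\<lambda>n. A u n + A v n)) \<and>
     (\<forall>u\<in>ell2. \<forall>c. A (\<lambda>n. c * u n) = (\<lambda>n. c * A u n)) \<and>
     (\<exists>C. \<forall>u\<in>ell2. ell2_norm (A u) \<le> C * ell2_norm u)"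


section \<open>Jacobi matrices\<close>

definition jacobi_entry :: "(nat \<Rightarrow> real) \<Rightarrow> (nat \<Rightarrow> real) \<Rightarrow> nat \<Rightarrow> nat \<Rightarrow> real" where
  "jacobi_entry a b m n =
     (if n = m then b m else if n = Suc m then a m else if m = Suc n then a n else 0)"

text \<open>Row \<open>m\<close> of the matrix has no non-zero entry beyond column \<open>m + 1\<close>.\<close>

definition jacobi_op :: "(nat \<Rightarrow> real) \<Rightarrow> (nat \<Rightarrow> real) \<Rightarrow> seq_op" where
  "jacobi_op a b u =
     (\<lambda>m. if m = 0 then 0 else \<Sum>n = 1..Suc m. of_real (jacobi_entry a b m n) * u n)"


section \<open>Spectral measures of bounded self-adjoint operators\<close>

definition op_spectrum :: "seq_op \<Rightarrow> complex set" where
  "op_spectrum A =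
     {z. \<not> (\<exists>R. bounded_op R \<and>
              (\<forall>u\<in>ell2. R (\<lambda>n. A u n - z * u n) = u \<and> (\<lambda>n. A (R u) n - z * R u n) = u))}"

definition real_spectrum :: "seq_op \<Rightarrow> real set" where
  "real_spectrum A = {x. complex_of_real x \<in> op_spectrum A}"

definition poly_op :: "real poly \<Rightarrow> seq_op \<Rightarrow> seq_op" where
  "poly_op p A u = (\<lambda>n. \<Sum>k\<le>degree p. of_real (coeff p k) * (A ^^ k) u n)"

text \<open>
  \<open>continuous_calculus A f T\<close> says that \<open>T = f(A)\<close> in the continuous functional calculus: \<open>T\<close> is
  the limit in operator norm of \<open>p\<^sub>k(A)\<close> for polynomials \<open>p\<^sub>k\<close> that converge to \<open>f\<close> uniformly on
  the spectrum. For self-adjoint \<open>A\<close> and \<open>f\<close> continuous on the spectrum, such a \<open>T\<close> exists and is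
  unique on \<open>ell2\<close>.
\<close>

definition continuous_calculus :: "seq_op \<Rightarrow> (real \<Rightarrow> real) \<Rightarrow> seq_op \<Rightarrow> bool" where
  "continuous_calculus A f T \<longleftrightarrow>
     bounded_op T \<and>
     (\<exists>p :: nat \<Rightarrow> real poly.
        uniform_limit (real_spectrum A) (\<lambda>k. poly (p k)) f sequentially \<and>
        (\<forall>e>0. \<forall>\<^sub>F k in sequentially. \<forall>u\<in>ell2.
           ell2_norm (\<lambda>n. poly_op (p k) A u n - T u n) \<le> e * ell2_norm u))"

text \<open>
  The measure \<open>\<nu>\<close> with \<open>\<langle>\<phi>, f(A) \<phi>\<rangle> = \<integral> f d\<nu>\<close> for every \<open>f\<close> continuous on the
  spectrum. For \<open>A\<close> bounded and self-adjoint it exists and is unique (spectral theorem).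
\<close>

definition is_spectral_measure :: "seq_op \<Rightarrow> (nat \<Rightarrow> complex) \<Rightarrow> real measure \<Rightarrow> bool" where
  "is_spectral_measure A \<phi> \<nu> \<longleftrightarrow>
     sets \<nu> = sets borel \<and> finite_measure \<nu> \<and>
     (AE x in \<nu>. x \<in> real_spectrum A) \<and>
     (\<forall>f T. continuous_on (real_spectrum A) f \<longrightarrow> continuous_calculus A f T \<longrightarrow>
        ell2_inner \<phi> (T \<phi>) = of_real (LINT x:real_spectrum A|\<nu>. f x))"


section \<open>Absolutely continuous part\<close>

text \<open>\<open>\<mu>\<close> is the absolutely continuous part in the Lebesgue decomposition \<open>\<nu> = \<mu> + \<sigma>\<close>.\<close>

definition is_ac_part :: "real measure \<Rightarrow> real measure \<Rightarrow> bool" where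
  "is_ac_part \<nu> \<mu> \<longleftrightarrow>
     sets \<mu> = sets borel \<and> absolutely_continuous lborel \<mu> \<and>
     (\<exists>\<sigma>. sets \<sigma> = sets borel \<and>
          (\<exists>N\<in>null_sets lborel. emeasure \<sigma> (- N) = 0) \<and>
          (\<forall>B\<in>sets borel. emeasure \<nu> B = emeasure \<mu> B + emeasure \<sigma> B))"

definition ac_part :: "real measure \<Rightarrow> real measure" where
  "ac_part \<nu> = (THE \<mu>. is_ac_part \<nu> \<mu>)"

definition ac_density :: "real measure \<Rightarrow> real \<Rightarrow> ennreal" where
  "ac_density \<nu> = RN_deriv lborel (ac_part \<nu>)"

lemma is_ac_part_unique:
  assumes "is_ac_part \<nu> \<mu>" "is_ac_part \<nu> \<mu>'"
  shows "\<mu> = \<mu>'"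
proof -
  from assms(1) obtain \<sigma> N where 1: "sets \<mu> = sets borel" "absolutely_continuous lborel \<mu>"
    "sets \<sigma> = sets borel" "N \<in> null_sets lborel" "emeasure \<sigma> (- N) = 0"
    "\<And>B. B \<in> sets borel \<Longrightarrow> emeasure \<nu> B = emeasure \<mu> B + emeasure \<sigma> B"
    unfolding is_ac_part_def by blast
  from assms(2) obtain \<sigma>' N' where 2: "sets \<mu>' = sets borel" "absolutely_continuous lborel \<mu>'"
    "sets \<sigma>' = sets borel" "N' \<in> null_sets lborel" "emeasure \<sigma>' (- N') = 0"
    "\<And>B. B \<in> sets borel \<Longrightarrow> emeasure \<nu> B = emeasure \<mu>' B + emeasure \<sigma>' B"
    unfolding is_ac_part_def by blast
  define M where "M = N \<union> N'"
  have M: "M \<in> null_sets lborel" using 1(4) 2(4) by (auto simp: M_def)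
  then have Mb: "M \<in> sets borel" by auto
  have Nb: "N \<in> sets borel" "N' \<in> sets borel" using 1(4) 2(4) by auto
  have M0: "emeasure \<mu> M = 0" "emeasure \<mu>' M = 0"
    using absolutely_continuousD[OF 1(2), of M] absolutely_continuousD[OF 2(2), of M] M
    by (auto simp: null_sets_def)
  have off: "emeasure \<mu> B = emeasure \<nu> (B - M) \<and> emeasure \<mu>' B = emeasure \<nu> (B - M)"
    if B: "B \<in> sets borel" for B
  proof -
    have "emeasure \<sigma> (B - M) \<le> emeasure \<sigma> (- N)" "emeasure \<sigma>' (B - M) \<le> emeasure \<sigma>' (- N')"
      using Nb 1(3) 2(3) by (auto intro!: emeasure_mono simp: M_def)
    then have "emeasure \<sigma> (B - M) = 0" "emeasure \<sigma>' (B - M) = 0"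
      using 1(5) 2(5) by auto
    moreover have "emeasure \<mu> (B - M) = emeasure \<mu> B" "emeasure \<mu>' (B - M) = emeasure \<mu>' B"
      using M0 Mb B 1(1) 2(1) by (auto intro!: emeasure_Diff_null_set simp: null_sets_def)
    ultimately show ?thesis using 1(6)[of "B - M"] 2(6)[of "B - M"] B Mb by auto
  qed
  show ?thesis
    by (rule measure_eqI) (simp_all add: 1(1) 2(1) off)
qed

lemma is_ac_part_exists:
  assumes "finite_measure \<nu>" and [simp]: "sets \<nu> = sets borel"
  shows "\<exists>\<mu>. is_ac_part \<nu> \<mu>"
proof -
  interpret finite_measure \<nu> by fact
  have [simp]: "space \<nu> = UNIV" using sets_eq_imp_space_eq[OF assms(2)] by simp
  let ?S = "emeasure \<nu> ` null_sets lborel"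
  have "\<exists>F :: nat \<Rightarrow> ennreal. range F \<subseteq> ?S \<and> Sup ?S = Sup (range F)"
    using ennreal_Sup_countable_SUP[of ?S] by auto
  then obtain F :: "nat \<Rightarrow> ennreal" where F: "range F \<subseteq> ?S" "Sup ?S = Sup (range F)" by blast
  then have "\<forall>i. \<exists>N\<in>null_sets lborel. F i = emeasure \<nu> N" by auto
  then obtain G where G: "\<And>i. G i \<in> null_sets lborel" "\<And>i. F i = emeasure \<nu> (G i)" by metis
  define N where "N = (\<Union>i. G i)"
  have N: "N \<in> null_sets lborel" using G by (auto simp: N_def)
  then have Nb: "N \<in> sets borel" by auto
  have max: "emeasure \<nu> K \<le> emeasure \<nu> N" if "K \<in> null_sets lborel" for K
  proof -
    have "emeasure \<nu> K \<le> Sup ?S" using that by (auto intro: Sup_upper)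
    also have "\<dots> \<le> emeasure \<nu> N"
      unfolding F(2) using Nb by (auto intro!: SUP_least emeasure_mono simp: G(2) N_def)
    finally show ?thesis .
  qed
  define \<mu> where "\<mu> = density \<nu> (indicator (- N))"
  define \<sigma> where "\<sigma> = density \<nu> (indicator N)"
  have sets: "sets \<mu> = sets borel" "sets \<sigma> = sets borel" by (auto simp: \<mu>_def \<sigma>_def)
  have e\<mu>: "emeasure \<mu> B = emeasure \<nu> (B - N)" and e\<sigma>: "emeasure \<sigma> B = emeasure \<nu> (B \<inter> N)"
    if "B \<in> sets borel" for B
    using that Nb unfolding \<mu>_def \<sigma>_def
    by (subst emeasure_restricted; simp add: Diff_eq Int_commute)+
  have "absolutely_continuous lborel \<mu>"
    unfolding absolutely_continuous_def
  proof
    fix K :: "real set" assume K: "K \<in> null_sets lborel"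
    then have Kb: "K \<in> sets borel" by auto
    have "emeasure \<nu> (K - N) + emeasure \<nu> N = emeasure \<nu> (K \<union> N)"
      using Kb Nb by (subst plus_emeasure) (auto intro: arg_cong[where f = "emeasure \<nu>"])
    also have "\<dots> \<le> 0 + emeasure \<nu> N" using max[OF null_sets.Un[OF K N]] by simp
    finally have "emeasure \<nu> (K - N) = 0"
      using emeasure_finite[of N] by (simp add: ennreal_add_left_cancel_le add.commute[of _ "emeasure \<nu> N"])
    then show "K \<in> null_sets \<mu>" using Kb sets e\<mu> by (auto simp: null_sets_def)
  qed
  moreover have "emeasure \<sigma> (- N) = 0" using e\<sigma>[of "- N"] Nb by auto
  moreover have "emeasure \<nu> B = emeasure \<mu> B + emeasure \<sigma> B" if "B \<in> sets borel" for B
    using plus_emeasure[of "B - N" \<nu> "B \<inter> N"] that Nb e\<mu> e\<sigma>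
    by (simp add: Un_Diff_Int Diff_Int_distrib2 disjoint_iff)
  ultimately show ?thesis unfolding is_ac_part_def using sets N by blast
qed

lemma is_ac_part_ac_part:
  assumes "finite_measure \<nu>" "sets \<nu> = sets borel"
  shows "is_ac_part \<nu> (ac_part \<nu>)"
  unfolding ac_part_def
  using is_ac_part_exists[OF assms] is_ac_part_unique by (metis theI)


section \<open>The Szego integral\<close>

text \<open>The integrand is \<open>\<infinity>\<close> where the density of the absolutely continuous part vanishes.\<close>

definition szego_integrand :: "real measure \<Rightarrow> real \<Rightarrow> ereal" where
  "szego_integrand \<nu> E =
     (if ac_density \<nu> E = 0 then \<infinity>
      else ereal (ln (sqrt (4 - E\<^sup>2) / (2 * pi * enn2real (ac_density \<nu> E))) / sqrt (4 - E\<^sup>2)))"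

definition szego_integral :: "real measure \<Rightarrow> ereal" where
  "szego_integral \<nu> = ereal (1 / (2 * pi)) *
     (enn2ereal (\<integral>\<^sup>+E\<in>{-2<..<2}. e2ennreal (szego_integrand \<nu> E) \<partial>lborel) -
      enn2ereal (\<integral>\<^sup>+E\<in>{-2<..<2}. e2ennreal (- szego_integrand \<nu> E) \<partial>lborel))"

text \<open>The two integrals above are never both infinite.\<close>

lemma szego_integral_negative_part_finite:
  assumes "finite_measure \<nu>" "sets \<nu> = sets borel"
  shows "(\<integral>\<^sup>+E\<in>{-2<..<2}. e2ennreal (- szego_integrand \<nu> E) \<partial>lborel) < \<infinity>"
proof -
  define w where "w = ac_density \<nu>"
  define h :: "real \<Rightarrow> ennreal" where "h = (\<lambda>x. ennreal (x powr (-3/4)) * indicator {0..4} x)"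
  have [measurable]: "w \<in> borel_measurable borel" "h \<in> borel_measurable borel"
    using borel_measurable_RN_deriv[of lborel "ac_part \<nu>"]
    by (simp_all add: w_def ac_density_def h_def)
  obtain \<sigma> where ac: "sets (ac_part \<nu>) = sets borel" "absolutely_continuous lborel (ac_part \<nu>)"
    and dec: "\<And>B. B \<in> sets borel \<Longrightarrow> emeasure \<nu> B = emeasure (ac_part \<nu>) B + emeasure \<sigma> B"
    using is_ac_part_ac_part[OF assms] unfolding is_ac_part_def by blast
  have dens: "density lborel w = ac_part \<nu>"
    unfolding w_def ac_density_def by (rule sigma_finite_measure.density_RN_deriv[OF sigma_finite_lborel]) (use ac in auto)
  have "(\<integral>\<^sup>+E. w E \<partial>lborel) = emeasure (density lborel w) UNIV"
    by (simp add: emeasure_density)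
  also have "\<dots> \<le> emeasure \<nu> UNIV" using dec[of UNIV] by (simp add: dens)
  also have "\<dots> < \<infinity>"
    using finite_measure.emeasure_finite[OF assms(1)] by (simp add: top.not_eq_extremum)
  finally have w_fin: "(\<integral>\<^sup>+E. w E \<partial>lborel) < \<infinity>" .
  then have w_AE: "AE E in lborel. w E \<noteq> \<infinity>"
    by (intro nn_integral_PInf_AE) auto
  have "((\<lambda>x::real. x powr (-3/4)) has_integral (4 powr (-3/4 + 1) / (-3/4 + 1))) {0..4}"
    by (rule has_integral_powr_from_0) auto
  then have "(\<integral>\<^sup>+x. h x \<partial>lborel) = ennreal (4 powr (-3/4 + 1) / (-3/4 + 1))"
    unfolding h_def by (intro nn_integral_has_integral_lebesgue') auto
  then have h_fin: "(\<integral>\<^sup>+x. h x \<partial>lborel) < \<infinity>" by simp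
  have h1: "(\<integral>\<^sup>+x. h (2 + x) \<partial>lborel) < \<infinity>"
    using h_fin nn_integral_real_affine[of h 1 2] by simp
  have h2: "(\<integral>\<^sup>+x. h (2 - x) \<partial>lborel) < \<infinity>"
    using h_fin nn_integral_real_affine[of h "-1" 2] by simp
  have bound: "e2ennreal (- szego_integrand \<nu> E) * indicator {-2<..<2} E
      \<le> ennreal (2 * pi) * w E + ennreal 4 * (h (2 + E) + h (2 - E))" if fin: "w E \<noteq> \<infinity>" for E
  proof (cases "w E = 0 \<or> E \<notin> {-2<..<2}")
    case True
    then show ?thesis by (auto simp: szego_integrand_def w_def e2ennreal_neg)
  next
    case False
    define t where "t = 4 - E\<^sup>2"
    define y where "y = enn2real (w E)"
    have E: "-2 < E" "E < 2" and w0: "w E \<noteq> 0" using False by auto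
    have teq: "t = (2 + E) * (2 - E)" by (simp add: t_def power2_eq_square algebra_simps)
    have t: "t > 0" using E unfolding teq by auto
    have wy: "w E = ennreal y" using fin by (simp add: y_def top.not_eq_extremum)
    have y: "y > 0" using w0 wy by (metis ennreal_eq_0_iff not_le)
    have q: "t powr (-3/4) \<le> (2 + E) powr (-3/4) + (2 - E) powr (-3/4)"
    proof (cases "E \<ge> 0")
      case True
      have "1 * (2 - E) \<le> t" unfolding teq using True E by (intro mult_right_mono) auto
      then have "t powr (-3/4) \<le> (2 - E) powr (-3/4)" using E by (intro powr_mono2') auto
      then show ?thesis using powr_ge_zero[of "2 + E" "-3/4"] by linarith
    next
      case False
      have "(2 + E) * 1 \<le> t" unfolding teq using False E by (intro mult_left_mono) auto
      then have "t powr (-3/4) \<le> (2 + E) powr (-3/4)" using E by (intro powr_mono2') auto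
      then show ?thesis using powr_ge_zero[of "2 - E" "-3/4"] by linarith
    qed
    have "ln (2 * pi * y * sqrt t) \<le> 2 * pi * y * sqrt t"
      using t y by (intro less_imp_le ln_less_self) auto
    moreover have "ln (t powr (-1/4)) \<le> t powr (-1/4)"
      using t by (intro less_imp_le ln_less_self) auto
    then have "- ln t \<le> 4 * t powr (-1/4)" using t by (simp add: ln_powr)
    ultimately have num: "- ln (sqrt t / (2 * pi * y)) \<le> 2 * pi * y * sqrt t + 4 * t powr (-1/4)"
      using t y by (simp add: ln_div ln_mult ln_sqrt)
    have "- (ln (sqrt t / (2 * pi * y)) / sqrt t) = - ln (sqrt t / (2 * pi * y)) / sqrt t" by simp
    also have "\<dots> \<le> (2 * pi * y * sqrt t + 4 * t powr (-1/4)) / sqrt t"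
      by (rule divide_right_mono[OF num]) (use t in auto)
    also have "\<dots> = 2 * pi * y + 4 * t powr (-3/4)"
    proof -
      have "t powr (-1/4) = t powr (-3/4) * sqrt t"
        using t by (simp add: powr_half_sqrt[symmetric] powr_add[symmetric])
      then show ?thesis using t by (simp add: field_simps)
    qed
    also have "\<dots> \<le> 2 * pi * y + 4 * ((2 + E) powr (-3/4) + (2 - E) powr (-3/4))" using q by simp
    finally have le: "- (ln (sqrt t / (2 * pi * y)) / sqrt t)
      \<le> 2 * pi * y + 4 * ((2 + E) powr (-3/4) + (2 - E) powr (-3/4))" .
    have "- szego_integrand \<nu> E = ereal (- (ln (sqrt t / (2 * pi * y)) / sqrt t))"
      using w0 by (simp add: szego_integrand_def w_def[symmetric] y_def t_def)
    then have "e2ennreal (- szego_integrand \<nu> E) = ennreal (- (ln (sqrt t / (2 * pi * y)) / sqrt t))"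
      by (simp only: ennreal.rep_eq e2ennreal_ereal)
    also have "\<dots> \<le> ennreal (2 * pi * y + 4 * ((2 + E) powr (-3/4) + (2 - E) powr (-3/4)))"
      by (rule ennreal_leI[OF le])
    also have "\<dots> = ennreal (2 * pi) * w E + ennreal 4 * (h (2 + E) + h (2 - E))"
      using E y by (simp add: h_def wy ennreal_mult ennreal_plus distrib_left del: ennreal_numeral)
    finally show ?thesis using E by simp
  qed
  have "(\<integral>\<^sup>+E\<in>{-2<..<2}. e2ennreal (- szego_integrand \<nu> E) \<partial>lborel)
      \<le> (\<integral>\<^sup>+E. ennreal (2 * pi) * w E + ennreal 4 * (h (2 + E) + h (2 - E)) \<partial>lborel)"
    by (rule nn_integral_mono_AE) (use w_AE bound in auto)
  also have "\<dots> = ennreal (2 * pi) * (\<integral>\<^sup>+E. w E \<partial>lborel) +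
      ennreal 4 * ((\<integral>\<^sup>+E. h (2 + E) \<partial>lborel) + (\<integral>\<^sup>+E. h (2 - E) \<partial>lborel))"
    by (simp add: nn_integral_add nn_integral_cmult del: ennreal_numeral)
  also have "\<dots> < \<infinity>"
    using w_fin h1 h2 by (simp add: ennreal_mult_less_top del: ennreal_numeral)
  finally show ?thesis .
qed

end

theory Submission
  imports Defs "HOL-Computational_Algebra.Fundamental_Theorem_Algebra" "HOL-Real_Asymp.Real_Asymp"
begin

text \<open>
  Reflecting \<open>E \<mapsto> - E\<close> if necessary, assume \<open>\<beta> > 2 \<alpha>\<close>. Let \<open>p\<^sub>n\<close> be the orthonormal polynomials and
  \<open>x\<^sub>j\<close> the zeros of \<open>p\<^sub>n\<close>, that is, the eigenvalues of the truncated matrix. If \<open>Z(J) < \<infinity>\<close>, then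
  \<open>\<integral> p\<^sub>n\<^sup>2 d\<nu> = 1\<close> and Jensen's inequality bound \<open>\<integral> ln |p\<^sub>n(2 cos t)| (1 - cos t) dt\<close> over
  \<open>[0, \<pi>]\<close> from above, independently of \<open>n\<close>. Since \<open>\<integral> ln |2 cos t - x| (1 - cos t) dt = \<pi> x / 2\<close> for
  \<open>|x| \<le> 2\<close>, the left-hand side is \<open>\<pi> (\<Sum> b\<^sub>k / 2 - \<Sum> ln a\<^sub>k)\<close> up to the contribution of zeros outside
  \<open>[-2, 2]\<close>. The zeros below \<open>-2\<close> only help. A zero \<open>x > 2\<close> costs at most a multiple of
  \<open>(x - 2) powr (5 / 4)\<close>, and the \<open>j\<close>-th largest zero is at most \<open>2 + C / j\<close>, because deleting the first
  \<open>j - 1\<close> rows and columns leaves a matrix bounded above by \<open>2 + C / j\<close>; so these costs are summable. But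
  \<open>\<Sum> (b\<^sub>k - 2 ln a\<^sub>k)\<close> grows like \<open>(\<beta> - 2 \<alpha>) ln n\<close>, a contradiction.
\<close>

section \<open>Polynomials of a Jacobi matrix\<close>

text \<open>The constant part of the weight \<open>1 - cos t\<close> detects the product of the
  \<open>a k\<close>, the cosine part the trace; their difference weighs -2 ln a_k against b_k
  exactly as in \<beta> - 2 \<alpha>. The weight is also nonnegative, so pointwise inequalities such
  as ln y <= y may be multiplied by it and integrated. The obstacle is a zero x above 2, where the
  potential falls short of \<pi> x / 2. Since the weight vanishes at E = 2, this deficit is only of
  order (x - 2)^(3/2) near 2. As nothing better than x_j - 2 <= C / j is known, an exponent above 1
  is indispensable, and 5 / 4 is one that still follows from an elementary bound for ln (1 + y). At
  E = -2 the weight does not vanish, but there the deviation has the favourable sign. This asymmetry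
  between the two ends is why only one sign of \<beta> is treated directly.\<close>

lemma jacobi_op_apply:
  "jacobi_op a b u m = (if m = 0 then 0 else of_real (b m) * u m + of_real (a m) * u (Suc m)
     + (if m = 1 then 0 else of_real (a (m - 1)) * u (m - 1)))"
proof (cases "m = 0")
  case False
  define S where "S = (if m = 1 then {m, Suc m} else {m - 1, m, Suc m})"
  have "(\<Sum>n = 1..Suc m. of_real (jacobi_entry a b m n) * u n)
      = (\<Sum>n\<in>S. of_real (jacobi_entry a b m n) * u n)"
    by (rule sum.mono_neutral_right) (use False in \<open>auto simp: S_def jacobi_entry_def split: if_splits\<close>)
  also have "\<dots> = of_real (b m) * u m + of_real (a m) * u (Suc m)
     + (if m = 1 then 0 else of_real (a (m - 1)) * u (m - 1))"
    using False by (cases m; cases "m - 1") (auto simp: S_def jacobi_entry_def algebra_simps)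
  finally show ?thesis using False by (simp add: jacobi_op_def)
qed (simp add: jacobi_op_def)

lemma jacobi_op_add: "jacobi_op a b (\<lambda>n. u n + v n) = (\<lambda>n. jacobi_op a b u n + jacobi_op a b v n)"
  by (rule ext) (simp add: jacobi_op_apply algebra_simps)

lemma jacobi_op_scale: "jacobi_op a b (\<lambda>n. c * u n) = (\<lambda>n. c * jacobi_op a b u n)"
  by (rule ext) (simp add: jacobi_op_apply algebra_simps)

lemma jacobi_pow_add:
  "(jacobi_op a b ^^ k) (\<lambda>n. u n + v n) = (\<lambda>n. (jacobi_op a b ^^ k) u n + (jacobi_op a b ^^ k) v n)"
  by (induction k) (simp_all only: funpow.simps comp_apply id_apply jacobi_op_add)

lemma jacobi_pow_scale:
  "(jacobi_op a b ^^ k) (\<lambda>n. c * u n) = (\<lambda>n. c * (jacobi_op a b ^^ k) u n)"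
  by (induction k) (simp_all only: funpow.simps comp_apply id_apply jacobi_op_scale)

lemma jacobi_op_delta:
  assumes "m \<ge> 1"
  shows "jacobi_op a b (delta m) = (\<lambda>n. of_real (b m) * delta m n + (of_real (a m) * delta (Suc m) n
     + (if m = 1 then 0 else of_real (a (m - 1))) * delta (m - 1) n))"
proof
  fix n
  obtain k where m: "m = Suc k" using assms by (cases m) auto
  show "jacobi_op a b (delta m) n = of_real (b m) * delta m n + (of_real (a m) * delta (Suc m) n
     + (if m = 1 then 0 else of_real (a (m - 1))) * delta (m - 1) n)"
  proof (cases n)
    case 0
    then show ?thesis by (simp add: m jacobi_op_apply delta_def)
  next
    case (Suc i)
    consider "i = k" | "i = Suc k" | "k = Suc i" | "i \<noteq> k" "i \<noteq> Suc k" "k \<noteq> Suc i" by blast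
    then show ?thesis
      by cases (simp_all add: Suc m jacobi_op_apply delta_def)
  qed
qed

text \<open>Symmetry is carried across one factor at a time: the operator sends
  \<open>delta l\<close> to neighbouring delta vectors with the coefficients of row
  \<open>l\<close>. Single entries are finite sums, so adjoints and convergence do not
  arise.\<close>

lemma jacobi_pow_symmetric:
  "\<lbrakk>m \<ge> 1; l \<ge> 1\<rbrakk> \<Longrightarrow> (jacobi_op a b ^^ k) (delta m) l = (jacobi_op a b ^^ k) (delta l) m"
proof (induction k arbitrary: l m)
  case 0
  then show ?case by (simp add: delta_def)
next
  case (Suc k)
  let ?A = "jacobi_op a b"
  have IH: "(?A ^^ k) (delta i) m = (?A ^^ k) (delta m) i" if "i \<ge> 1" for i
    by (rule Suc.IH[OF that Suc.prems(1)])
  have "(?A ^^ Suc k) (delta l) m = (?A ^^ k) (?A (delta l)) m"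
    by (simp add: funpow_swap1)
  also have "\<dots> = of_real (b l) * (?A ^^ k) (delta l) m + (of_real (a l) * (?A ^^ k) (delta (Suc l)) m
     + (if l = 1 then 0 else of_real (a (l - 1))) * (?A ^^ k) (delta (l - 1)) m)"
    using Suc.prems by (simp only: jacobi_op_delta jacobi_pow_add jacobi_pow_scale)
  also have "\<dots> = of_real (b l) * (?A ^^ k) (delta m) l + (of_real (a l) * (?A ^^ k) (delta m) (Suc l)
     + (if l = 1 then 0 else of_real (a (l - 1))) * (?A ^^ k) (delta m) (l - 1))"
    using IH[of l] IH[of "Suc l"] IH[of "l - 1"] Suc.prems(2)
    by (intro arg_cong2[where f = "(+)"]) (cases "l = 1"; simp)+
  also have "\<dots> = (?A ^^ Suc k) (delta m) l"
    using Suc.prems by (auto simp: jacobi_op_apply)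
  finally show ?case by (rule sym)
qed

section \<open>Operator polynomials and orthonormal polynomials\<close>

lemma poly_op_bound:
  assumes "degree p \<le> d"
  shows "poly_op p A u n = (\<Sum>k\<le>d. of_real (coeff p k) * (A ^^ k) u n)"
  unfolding poly_op_def
  by (rule sum.mono_neutral_left) (use assms in \<open>auto simp: coeff_eq_0\<close>)

lemma poly_op_add: "poly_op (p + q) A u n = poly_op p A u n + poly_op q A u n"
proof -
  define d where "d = max (degree p) (degree q)"
  have "degree (p + q) \<le> d" "degree p \<le> d" "degree q \<le> d"
    by (auto simp: d_def degree_add_le_max)
  then show ?thesis
    by (simp add: poly_op_bound sum.distrib[symmetric] algebra_simps)
qed

lemma poly_op_smult: "poly_op (smult c p) A u n = of_real c * poly_op p A u n"
  by (simp add: poly_op_bound[OF degree_smult_le] poly_op_bound[of p "degree p"] sum_distrib_left mult.assoc)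

lemma poly_op_pCons_0: "poly_op (pCons 0 p) A u = poly_op p A (A u)"
proof (rule ext)
  fix n
  have "degree (pCons 0 p) \<le> Suc (degree p)" by (simp add: degree_pCons_le)
  then show "poly_op (pCons 0 p) A u n = poly_op p A (A u) n"
    by (simp add: poly_op_bound poly_op_def sum.atMost_Suc_shift funpow_swap1 del: sum.atMost_Suc)
qed

lemma poly_op_0: "poly_op 0 A u n = 0"
  by (simp add: poly_op_def)

lemma poly_op_1: "poly_op 1 A u = u"
  by (rule ext) (simp add: poly_op_def)

lemma poly_op_jacobi_add:
  "poly_op p (jacobi_op a b) (\<lambda>n. u n + v n) n
    = poly_op p (jacobi_op a b) u n + poly_op p (jacobi_op a b) v n"
  by (simp only: poly_op_def jacobi_pow_add distrib_left sum.distrib)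

lemma poly_op_jacobi_scale:
  "poly_op p (jacobi_op a b) (\<lambda>n. c * u n) n = c * poly_op p (jacobi_op a b) u n"
  by (simp only: poly_op_def jacobi_pow_scale mult.left_commute[of _ c] sum_distrib_left)

text \<open>Over an arbitrary field, because the zeros are first found among the complex numbers and
  then shown to be real.\<close>

fun orthpoly :: "(nat \<Rightarrow> 'a::field) \<Rightarrow> (nat \<Rightarrow> 'a) \<Rightarrow> nat \<Rightarrow> 'a poly" where
  "orthpoly a b 0 = 1"
| "orthpoly a b (Suc 0) = smult (1 / a 1) [:- b 1, 1:]"
| "orthpoly a b (Suc (Suc n)) = smult (1 / a (Suc (Suc n)))
     ([:- b (Suc (Suc n)), 1:] * orthpoly a b (Suc n) - smult (a (Suc n)) (orthpoly a b n))"

text \<open>The variable is moved from \<open>P\<close> onto \<open>Q\<close>, as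
  \<open>pCons 0 Q\<close>; \<open>poly_op_pCons_0\<close> then turns it into one application of the
  operator to the vector.\<close>

lemma mult_three_term:
  fixes P Q R :: "'a::comm_ring_1 poly"
  shows "Q * smult c ([:- d, 1:] * P - smult e R)
    = smult c (pCons 0 Q * P + smult (- d) (Q * P) + smult (- e) (Q * R))"
proof -
  have "[:- d, 1:] * P = pCons 0 P + smult (- d) P" by (simp add: mult_pCons_left)
  moreover have "pCons 0 Q * P = Q * pCons 0 P" by simp
  ultimately show ?thesis
    by (simp only: mult_smult_right distrib_left right_diff_distrib smult_minus_left diff_conv_add_uminus mult_minus_right)
qed

text \<open>In essence p_n(J) delta_1 = delta_(n+1): the three-term recurrence is the action of the
  matrix on delta vectors. The factor \<open>q\<close> stays arbitrary so that the induction can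
  absorb the variable of the recurrence into it.\<close>

lemma poly_op_orthpoly:
  fixes a b :: "nat \<Rightarrow> real"
  assumes pos: "\<And>n. n \<ge> 1 \<Longrightarrow> a n > 0"
  shows "poly_op (q * orthpoly a b n) (jacobi_op a b) (delta 1) m = poly_op q (jacobi_op a b) (delta (Suc n)) m"
proof (induction n arbitrary: q rule: induct_nat_012)
  case 0
  then show ?case by simp
next
  case 1
  have a: "a 1 \<noteq> 0" using pos[of 1] by simp
  have "q * orthpoly a b (Suc 0) = smult (1 / a 1) (pCons 0 q + smult (- b 1) q)"
    by (simp add: smult_diff_right)
  also have "poly_op \<dots> (jacobi_op a b) (delta 1) m =
     of_real (1 / a 1) * (poly_op q (jacobi_op a b) (jacobi_op a b (delta 1)) m - of_real (b 1) * poly_op q (jacobi_op a b) (delta 1) m)"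
    by (simp only: poly_op_smult poly_op_add poly_op_pCons_0) simp
  also have "poly_op q (jacobi_op a b) (jacobi_op a b (delta 1)) m
      = of_real (b 1) * poly_op q (jacobi_op a b) (delta 1) m + of_real (a 1) * poly_op q (jacobi_op a b) (delta (Suc (Suc 0))) m"
    by (simp only: jacobi_op_delta[OF order_refl] poly_op_jacobi_add poly_op_jacobi_scale) simp
  also have "of_real (1 / a 1) * (of_real (b 1) * poly_op q (jacobi_op a b) (delta 1) m
      + of_real (a 1) * poly_op q (jacobi_op a b) (delta (Suc (Suc 0))) m
      - of_real (b 1) * poly_op q (jacobi_op a b) (delta 1) m) = poly_op q (jacobi_op a b) (delta (Suc (Suc 0))) m"
    using a by simp
  finally show ?case .
next
  case (ge2 n)
  let ?A = "jacobi_op a b" and ?N = "Suc (Suc n)"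
  have a: "a ?N \<noteq> 0" using pos[of ?N] by simp
  have E1: "q * orthpoly a b ?N = smult (1 / a ?N) (pCons 0 q * orthpoly a b (Suc n)
      + smult (- b ?N) (q * orthpoly a b (Suc n)) + smult (- a (Suc n)) (q * orthpoly a b n))"
    by (simp only: orthpoly.simps mult_three_term)
  have E2: "poly_op q ?A (?A (delta ?N)) m = of_real (b ?N) * poly_op q ?A (delta ?N) m
      + (of_real (a ?N) * poly_op q ?A (delta (Suc ?N)) m + of_real (a (Suc n)) * poly_op q ?A (delta (Suc n)) m)"
    by (subst jacobi_op_delta, simp, simp only: poly_op_jacobi_add poly_op_jacobi_scale) simp
  show ?case
    unfolding E1 poly_op_smult poly_op_add ge2 poly_op_pCons_0 E2
    using a by (simp add: algebra_simps)
qed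

lemma poly_op_orthpoly_square:
  fixes a b :: "nat \<Rightarrow> real"
  assumes pos: "\<And>n. n \<ge> 1 \<Longrightarrow> a n > 0"
  shows "poly_op (orthpoly a b n * orthpoly a b n) (jacobi_op a b) (delta 1) 1 = 1"
proof -
  have "poly_op (orthpoly a b n * orthpoly a b n) (jacobi_op a b) (delta 1) 1
      = poly_op (orthpoly a b n) (jacobi_op a b) (delta (Suc n)) 1"
    by (rule poly_op_orthpoly[OF pos])
  \<comment> \<open>Symmetry of the matrix powers exchanges the two coordinates, so that
    \<open>poly_op_orthpoly\<close> applies a second time, with \<open>q = 1\<close>.\<close>
  also have "\<dots> = poly_op (orthpoly a b n) (jacobi_op a b) (delta 1) (Suc n)"
    unfolding poly_op_def by (intro sum.cong refl arg_cong2[where f = "(*)"] jacobi_pow_symmetric) auto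
  also have "\<dots> = 1"
    using poly_op_orthpoly[OF pos, where q = 1 and n = n and m = "Suc n"] by (simp add: poly_op_1 delta_def)
  finally show ?thesis .
qed

section \<open>Coefficients and symmetries of the orthonormal polynomials\<close>

lemma orthpoly_recurrence:
  fixes a b :: "nat \<Rightarrow> 'a::field"
  assumes "\<And>n. n \<ge> 1 \<Longrightarrow> a n \<noteq> 0"
  shows "poly (orthpoly a b 0) x = 1"
    and "a (Suc 0) * poly (orthpoly a b (Suc 0)) x = x - b (Suc 0)"
    and "a (Suc (Suc n)) * poly (orthpoly a b (Suc (Suc n))) x
      = (x - b (Suc (Suc n))) * poly (orthpoly a b (Suc n)) x - a (Suc n) * poly (orthpoly a b n) x"
  using assms[of "Suc 0"] assms[of "Suc (Suc n)"] by (simp_all add: algebra_simps)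

text \<open>The data for Vieta's formulas: the second coefficient carries the trace of the truncated
  matrix. The shift by \<open>pCons 0\<close> yields the coefficient of index \<open>n - 1\<close>,
  and \<open>0\<close> when \<open>n = 0\<close>.\<close>

lemma orthpoly_top_coeffs:
  fixes a b :: "nat \<Rightarrow> 'a::field"
  assumes nz: "\<And>n. n \<ge> 1 \<Longrightarrow> a n \<noteq> 0"
  shows "degree (orthpoly a b n) = n \<and> coeff (orthpoly a b n) n = 1 / (\<Prod>k=1..n. a k)
    \<and> coeff (pCons 0 (orthpoly a b n)) n = - (\<Sum>k=1..n. b k) / (\<Prod>k=1..n. a k)"
proof (induction n rule: induct_nat_012)
  case 0
  then show ?case by simp
next
  case 1
  then show ?case using nz[of 1] by simp
next
  case (ge2 n)
  let ?N = "Suc (Suc n)"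
  have step: "coeff (orthpoly a b ?N) (Suc m) = (coeff (orthpoly a b (Suc n)) m - b ?N * coeff (orthpoly a b (Suc n)) (Suc m)
      - a (Suc n) * coeff (orthpoly a b n) (Suc m)) / a ?N" for m
    by (simp add: field_simps)
  have z: "coeff (orthpoly a b n) m = 0" if "m > n" for m
    using ge2.IH(1) that by (intro coeff_eq_0) simp
  have z': "coeff (orthpoly a b (Suc n)) m = 0" if "m > Suc n" for m
    using ge2.IH(2) that by (intro coeff_eq_0) simp
  have top: "coeff (orthpoly a b ?N) ?N = 1 / (\<Prod>k=1..?N. a k)"
    unfolding step using ge2.IH by (simp add: z z')
  have nxt: "coeff (orthpoly a b ?N) (Suc n) = - (\<Sum>k=1..?N. b k) / (\<Prod>k=1..?N. a k)"
  proof -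
    define A B where "A = (\<Prod>k=1..Suc n. a k)" and "B = (\<Sum>k=1..Suc n. b k)"
    have c: "coeff (orthpoly a b (Suc n)) (Suc n) = 1 / A" "coeff (orthpoly a b (Suc n)) n = - B / A"
      using ge2.IH(2) unfolding A_def B_def by simp_all
    have e: "(\<Prod>k=1..?N. a k) = A * a ?N" "(\<Sum>k=1..?N. b k) = B + b ?N"
      by (simp_all add: A_def B_def)
    show ?thesis unfolding step c e z[OF lessI] by (simp add: diff_divide_distrib add_divide_distrib)
  qed
  have "degree (orthpoly a b ?N) \<le> ?N"
  proof (rule degree_le, intro allI impI)
    fix i assume "?N < i"
    then obtain m where "i = Suc m" "Suc n < m" by (cases i) auto
    then show "coeff (orthpoly a b ?N) i = 0" using step[of m] by (simp add: z z' del: orthpoly.simps)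
  qed
  moreover have "coeff (orthpoly a b ?N) ?N \<noteq> 0"
    unfolding top using nz by simp
  ultimately have "degree (orthpoly a b ?N) = ?N"
    using le_degree by (metis order_antisym)
  then show ?case using top nxt by simp
qed

lemma orthpoly_reflect:
  fixes a b :: "nat \<Rightarrow> 'a::field"
  shows "poly (orthpoly a (\<lambda>k. - b k) n) x = (- 1) ^ n * poly (orthpoly a b n) (- x)"
  by (induction n rule: induct_nat_012) (simp_all add: algebra_simps)

lemma orthpoly_of_real:
  "poly (orthpoly (\<lambda>k. of_real (a k)) (\<lambda>k. of_real (b k)) n) (of_real x :: 'a::real_field)
    = of_real (poly (orthpoly a b n) x)"
  by (induction n rule: induct_nat_012) (simp_all add: algebra_simps)

lemma orthpoly_cnj:
  "poly (orthpoly (\<lambda>k. of_real (a k)) (\<lambda>k. of_real (b k)) n) (cnj z)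
    = cnj (poly (orthpoly (\<lambda>k. of_real (a k)) (\<lambda>k. of_real (b k)) n) z)"
  by (induction n rule: induct_nat_012) (simp_all add: algebra_simps)

section \<open>Christoffel-Darboux identities and the zeros\<close>

text \<open>The right-hand side vanishes when both points are zeros of the polynomial of degree
  \<open>Suc n\<close>. A zero and its conjugate then give reality, two distinct real zeros the
  orthogonality of eigenvectors of the truncated matrix.\<close>

lemma christoffel_darboux:
  fixes a b :: "nat \<Rightarrow> 'a::field"
  assumes nz: "\<And>n. n \<ge> 1 \<Longrightarrow> a n \<noteq> 0"
  defines "p \<equiv> \<lambda>k x. poly (orthpoly a b k) x"
  shows "(x - y) * (\<Sum>k\<le>n. p k x * p k y) = a (Suc n) * (p (Suc n) x * p n y - p n x * p (Suc n) y)"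
proof (induction n)
  case 0
  have "a (Suc 0) * (p (Suc 0) x * p 0 y - p 0 x * p (Suc 0) y)
      = a (Suc 0) * p (Suc 0) x * p 0 y - p 0 x * (a (Suc 0) * p (Suc 0) y)"
    by (simp add: algebra_simps)
  also have "\<dots> = x - y"
    using nz[of "Suc 0"] by (simp add: p_def field_simps)
  finally show ?case by (simp add: p_def)
next
  case (Suc n)
  let ?N = "Suc (Suc n)"
  have px: "a ?N * p ?N x = (x - b ?N) * p (Suc n) x - a (Suc n) * p n x"
    and py: "a ?N * p ?N y = (y - b ?N) * p (Suc n) y - a (Suc n) * p n y"
    unfolding p_def by (rule orthpoly_recurrence(3)[OF nz], assumption)+
  have "a ?N * (p ?N x * p (Suc n) y - p (Suc n) x * p ?N y)
      = a ?N * p ?N x * p (Suc n) y - p (Suc n) x * (a ?N * p ?N y)"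
    by (simp add: algebra_simps)
  also have "\<dots> = ((x - b ?N) * p (Suc n) x - a (Suc n) * p n x) * p (Suc n) y
     - p (Suc n) x * ((y - b ?N) * p (Suc n) y - a (Suc n) * p n y)"
    by (simp only: px py)
  also have "\<dots> = (x - y) * (p (Suc n) x * p (Suc n) y)
     + a (Suc n) * (p (Suc n) x * p n y - p n x * p (Suc n) y)"
    by (simp add: algebra_simps)
  also have "\<dots> = (x - y) * (\<Sum>k\<le>Suc n. p k x * p k y)"
    unfolding Suc[symmetric] by (simp add: algebra_simps)
  finally show ?case ..
qed

text \<open>The limit y -> x of the preceding identity. A double real zero of the polynomial of
  degree \<open>Suc n\<close> would make the positive sum of squares vanish, so the zeros are
  simple.\<close>

lemma christoffel_darboux_confluent:
  fixes a b :: "nat \<Rightarrow> 'a::field" and x :: 'a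
  assumes nz: "\<And>n. n \<ge> 1 \<Longrightarrow> a n \<noteq> 0"
  defines "p \<equiv> \<lambda>k. poly (orthpoly a b k) x" and "d \<equiv> \<lambda>k. poly (pderiv (orthpoly a b k)) x"
  shows "(\<Sum>k\<le>n. p k * p k) = a (Suc n) * (d (Suc n) * p n - d n * p (Suc n))"
proof (induction n)
  case 0
  show ?case using nz[of 1] by (simp add: p_def d_def pderiv_smult pderiv_pCons)
next
  case (Suc n)
  let ?N = "Suc (Suc n)"
  have d: "a ?N * d ?N = p (Suc n) + (x - b ?N) * d (Suc n) - a (Suc n) * d n"
    using nz[of ?N] by (simp add: p_def d_def pderiv_smult pderiv_diff pderiv_add pderiv_mult pderiv_pCons algebra_simps)
  have p: "a ?N * p ?N = (x - b ?N) * p (Suc n) - a (Suc n) * p n"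
    unfolding p_def by (rule orthpoly_recurrence(3)[OF nz])
  have "a ?N * (d ?N * p (Suc n) - d (Suc n) * p ?N) = a ?N * d ?N * p (Suc n) - d (Suc n) * (a ?N * p ?N)"
    by (simp add: algebra_simps)
  also have "\<dots> = p (Suc n) * p (Suc n) + a (Suc n) * (d (Suc n) * p n - d n * p (Suc n))"
    unfolding d p by (simp add: algebra_simps)
  also have "\<dots> = (\<Sum>k\<le>Suc n. p k * p k)"
    unfolding Suc[symmetric] by (simp add: algebra_simps)
  finally show ?case ..
qed

lemma coeffs_prod_linear_factors:
  fixes S :: "'a::idom set"
  assumes "finite S"
  shows "degree (\<Prod>s\<in>S. [:- s, 1:]) = card S \<and> coeff (\<Prod>s\<in>S. [:- s, 1:]) (card S) = 1
    \<and> coeff (pCons 0 (\<Prod>s\<in>S. [:- s, 1:])) (card S) = - (\<Sum>s\<in>S. s)"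
  using assms
proof induction
  case empty
  show ?case by simp
next
  case (insert x S)
  let ?P = "\<Prod>s\<in>S. [:- s, 1:]"
  have nz: "?P \<noteq> 0" using insert by auto
  have deg: "degree ([:- x, 1:] * ?P) = Suc (card S)"
    using insert nz by (simp add: degree_mult_eq del: mult_pCons_left)
  have "coeff ?P (Suc (card S)) = 0" using insert by (intro coeff_eq_0) simp
  then show ?case using insert deg by (cases "card S") (simp_all add: coeff_pCons)
qed

lemma orthpoly_sum_squares_pos:
  fixes a b :: "nat \<Rightarrow> real"
  shows "(\<Sum>k\<le>n. poly (orthpoly a b k) x * poly (orthpoly a b k) x) > 0"
proof -
  have "0 < (1::real)" by simp
  also have "1 = (\<Sum>k\<in>{0}. poly (orthpoly a b k) x * poly (orthpoly a b k) x)" by simp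
  also have "\<dots> \<le> (\<Sum>k\<le>n. poly (orthpoly a b k) x * poly (orthpoly a b k) x)"
    by (rule sum_mono2) auto
  finally show ?thesis .
qed

text \<open>The polynomial splits over the complex numbers, and the two Christoffel-Darboux
  identities make its zeros real and simple, so a set of \<open>n\<close> real numbers lists them
  all. Comparing second coefficients equates their sum with the trace.\<close>

lemma orthpoly_factorization:
  fixes a b :: "nat \<Rightarrow> real" and n :: nat
  assumes pos: "\<And>n. n \<ge> 1 \<Longrightarrow> a n > 0"
  defines "S \<equiv> {x. poly (orthpoly a b n) x = 0}"
  shows "finite S" "card S = n" "(\<Sum>s\<in>S. s) = (\<Sum>k=1..n. b k)"
    "poly (orthpoly a b n) x = (\<Prod>s\<in>S. x - s) / (\<Prod>k=1..n. a k)"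
proof -
  define ca cb where "ca = (\<lambda>k. complex_of_real (a k))" and "cb = (\<lambda>k. complex_of_real (b k))"
  define P where "P = orthpoly ca cb n"
  have nz: "ca k \<noteq> 0" if "k \<ge> 1" for k using pos[OF that] by (simp add: ca_def)
  have nzr: "a k \<noteq> 0" if "k \<ge> 1" for k using pos[OF that] by simp
  note top = orthpoly_top_coeffs[where a = ca and b = cb and n = n, OF nz, folded P_def]
  have lc: "lead_coeff P = 1 / (\<Prod>k=1..n. ca k)" using top by simp
  have P0: "P \<noteq> 0" using lc nz by auto
  have real_root: "z = of_real (Re z)" if "poly P z = 0" for z
  proof (cases n)
    case 0
    then show ?thesis using that by (simp add: P_def)
  next
    case (Suc m)
    define q where "q k = poly (orthpoly ca cb k) z" for k
    have "(z - cnj z) * (\<Sum>k\<le>m. q k * cnj (q k)) = 0"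
      using christoffel_darboux[where a = ca and b = cb and x = z and y = "cnj z" and n = m, OF nz] that
      by (simp add: q_def P_def Suc ca_def cb_def orthpoly_cnj del: orthpoly.simps)
    moreover have "(\<Sum>k\<le>m. q k * cnj (q k)) = of_real (\<Sum>k\<le>m. (cmod (q k))\<^sup>2)"
      by (simp only: complex_norm_square[symmetric] of_real_sum)
    moreover have "(\<Sum>k\<le>m. (cmod (q k))\<^sup>2) \<ge> (\<Sum>k\<in>{0}. (cmod (q k))\<^sup>2)"
      by (rule sum_mono2) auto
    then have "(\<Sum>k\<le>m. (cmod (q k))\<^sup>2) \<noteq> 0" by (simp add: q_def)
    ultimately have "z - cnj z = 0" by (metis mult_eq_0_iff of_real_eq_0_iff)
    then show ?thesis by (simp add: complex_eq_iff)
  qed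
  have ev: "poly P (of_real x) = of_real (poly (orthpoly a b n) x)" for x
    by (simp add: P_def ca_def cb_def orthpoly_of_real)
  have roots: "{z. poly P z = 0} = of_real ` S"
  proof safe
    fix z assume z: "poly P z = 0"
    have "poly P (of_real (Re z)) = 0" using z real_root[OF z] by simp
    then have "Re z \<in> S" by (simp add: ev S_def)
    then show "z \<in> of_real ` S" using real_root[OF z] by blast
  next
    fix x assume "x \<in> S" then show "poly P (of_real x) = 0" by (simp add: ev S_def)
  qed
  have "rsquarefree P"
    unfolding rsquarefree_roots
  proof (intro allI notI, elim conjE)
    fix z assume z: "poly P z = 0" "poly (pderiv P) z = 0"
    show False
    proof (cases n)
      case 0
      then show ?thesis using z by (simp add: P_def)
    next
      case (Suc m)
      define q where "q k = poly (orthpoly ca cb k) z" for k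
      have "(\<Sum>k\<le>m. q k * q k) = 0"
        using christoffel_darboux_confluent[where a = ca and b = cb and x = z and n = m, OF nz] z
        by (simp add: q_def P_def Suc del: orthpoly.simps)
      moreover have "q k = of_real (poly (orthpoly a b k) (Re z))" for k
        unfolding q_def by (subst real_root[OF z(1)]) (simp add: ca_def cb_def orthpoly_of_real)
      ultimately have "of_real (\<Sum>k\<le>m. poly (orthpoly a b k) (Re z) * poly (orthpoly a b k) (Re z)) = (0::complex)"
        by simp
      then show False using orthpoly_sum_squares_pos[of a b "Re z" m] by (simp only: of_real_eq_0_iff)
    qed
  qed
  then have dec: "smult (lead_coeff P) (\<Prod>z\<in>of_real ` S. [:- z, 1:]) = P"
    using complex_poly_decompose_rsquarefree roots by metis
  have "finite (of_real ` S :: complex set)" using poly_roots_finite[OF P0] roots by simp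
  then show fin: "finite S" by (rule finite_imageD) (auto intro: inj_onI)
  have inj: "inj_on (of_real :: real \<Rightarrow> complex) S" by (auto intro: inj_onI)
  have fc: "finite (of_real ` S :: complex set)" using fin by simp
  note cl = coeffs_prod_linear_factors[OF fc]
  have lc0: "lead_coeff P \<noteq> 0" using P0 by simp
  show cS: "card S = n"
  proof -
    have "degree P = card (of_real ` S :: complex set)"
      by (subst dec[symmetric]) (use cl lc0 in simp)
    then show ?thesis using top by (simp add: card_image[OF inj])
  qed
  have "coeff (pCons 0 P) n = lead_coeff P * coeff (pCons 0 (\<Prod>z\<in>of_real ` S. [:- z, 1:])) n"
    by (subst (1) dec[symmetric]) (simp add: coeff_pCons split: nat.split)
  also have "\<dots> = lead_coeff P * - (\<Sum>z\<in>of_real ` S. z)"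
    using cl by (simp add: card_image[OF inj] cS)
  finally have "- (\<Sum>k=1..n. cb k) / (\<Prod>k=1..n. ca k) = lead_coeff P * - (\<Sum>s\<in>S. of_real s)"
    using top by (simp add: sum.reindex[OF inj])
  then have "(\<Sum>s\<in>S. complex_of_real s) = (\<Sum>k=1..n. cb k)"
    using lc0 unfolding lc by simp
  then have "complex_of_real (\<Sum>s\<in>S. s) = of_real (\<Sum>k=1..n. b k)" by (simp add: cb_def)
  then show "(\<Sum>s\<in>S. s) = (\<Sum>k=1..n. b k)" by (simp only: of_real_eq_iff)
  have "complex_of_real (poly (orthpoly a b n) x) = poly (smult (lead_coeff P) (\<Prod>z\<in>of_real ` S. [:- z, 1:])) (of_real x)"
    unfolding dec ev ..
  also have "\<dots> = of_real ((\<Prod>s\<in>S. x - s) / (\<Prod>k=1..n. a k))"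
    by (simp add: poly_prod prod.reindex[OF inj] lc ca_def)
  finally show "poly (orthpoly a b n) x = (\<Prod>s\<in>S. x - s) / (\<Prod>k=1..n. a k)"
    by (simp only: of_real_eq_iff)
qed

section \<open>Counting large zeros\<close>

text \<open>A homogeneous linear system with more unknowns than equations, by elimination: the last
  equation is solved for a pivot \<open>s0\<close> and substituted into the others.\<close>

lemma exists_nontrivial_relation:
  fixes f :: "nat \<Rightarrow> 'b \<Rightarrow> 'a::field"
  assumes "finite S" "card S > m"
  shows "\<exists>c. (\<exists>s\<in>S. c s \<noteq> 0) \<and> (\<forall>i<m. (\<Sum>s\<in>S. c s * f i s) = 0)"
  using assms
proof (induction m arbitrary: S f)
  case 0
  then have "S \<noteq> {}" by auto
  then show ?case by (intro exI[of _ "\<lambda>_. 1"]) auto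
next
  case (Suc m)
  show ?case
  proof (cases "\<forall>s\<in>S. f m s = 0")
    case True
    from Suc.prems have "card S > m" by simp
    from Suc.IH[OF Suc.prems(1) this, of f] obtain c where c: "\<exists>s\<in>S. c s \<noteq> 0" "\<forall>i<m. (\<Sum>s\<in>S. c s * f i s) = 0"
      by blast
    have "(\<Sum>s\<in>S. c s * f m s) = 0" using True by simp
    then show ?thesis using c less_Suc_eq by (intro exI[of _ c]) auto
  next
    case False
    then obtain s0 where s0: "s0 \<in> S" "f m s0 \<noteq> 0" by blast
    define S' where "S' = S - {s0}"
    have fin: "finite S'" and card: "card S' > m" using Suc.prems s0 by (auto simp: S'_def)
    from Suc.IH[OF this, of "\<lambda>i s. f i s - f i s0 * f m s / f m s0"]
    obtain c where c: "\<exists>s\<in>S'. c s \<noteq> 0" "\<forall>i<m. (\<Sum>s\<in>S'. c s * (f i s - f i s0 * f m s / f m s0)) = 0"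
      by blast
    define d where "d s = (if s = s0 then - (\<Sum>s\<in>S'. c s * f m s) / f m s0 else c s)" for s
    have split: "(\<Sum>s\<in>S. d s * f i s) = (\<Sum>s\<in>S'. c s * (f i s - f i s0 * f m s / f m s0))" for i
    proof -
      have "(\<Sum>s\<in>S. d s * f i s) = d s0 * f i s0 + (\<Sum>s\<in>S'. d s * f i s)"
        unfolding S'_def using Suc.prems(1) s0(1) by (rule sum.remove)
      also have "(\<Sum>s\<in>S'. d s * f i s) = (\<Sum>s\<in>S'. c s * f i s)"
        by (rule sum.cong) (auto simp: d_def S'_def)
      also have "d s0 * f i s0 = - (\<Sum>s\<in>S'. c s * (f i s0 * f m s / f m s0))"
        by (simp add: d_def sum_distrib_left sum_distrib_right sum_divide_distrib sum_negf[symmetric] mult_ac)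
      finally show ?thesis by (simp add: right_diff_distrib sum_subtractf)
    qed
    have "(\<Sum>s\<in>S. d s * f i s) = 0" if "i < Suc m" for i
    proof (cases "i = m")
      case True
      then show ?thesis using s0 by (simp add: split)
    next
      case False
      then show ?thesis using that c(2) by (simp add: split)
    qed
    moreover have "\<exists>s\<in>S. d s \<noteq> 0" using c(1) by (auto simp: d_def S'_def)
    ultimately show ?thesis by blast
  qed
qed

text \<open>A combination of \<open>m + 1\<close> eigenvectors of the truncated matrix, all with eigenvalue above
  \<open>t\<close>, can be chosen to vanish in the first \<open>m\<close> coordinates, where the quadratic form of
  the matrix is at most \<open>t\<close>.\<close>

lemma card_orthpoly_roots_greater:
  fixes a b :: "nat \<Rightarrow> real"
  assumes pos: "\<And>n. n \<ge> 1 \<Longrightarrow> a n > 0"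
    and form: "\<And>k. k > m \<Longrightarrow> b k + a k + (if k = 1 then 0 else a (k - 1)) \<le> t"
  shows "card {x. poly (orthpoly a b n) x = 0 \<and> x > t} \<le> m"
proof (rule ccontr)
  assume "\<not> ?thesis"
  then have card: "m < card {x. poly (orthpoly a b n) x = 0 \<and> x > t}" by simp
  define S where "S = {x. poly (orthpoly a b n) x = 0 \<and> x > t}"
  define p where "p i x = poly (orthpoly a b i) x" for i x
  have nz: "a k \<noteq> 0" if "k \<ge> 1" for k using pos[OF that] by simp
  have fin: "finite S" by (rule finite_subset[OF _ orthpoly_factorization(1)[where a = a and b = b and n = n, OF pos]]) (auto simp: S_def)
  have "S \<noteq> {}" using card unfolding S_def[symmetric] by auto
  then have "n \<noteq> 0" by (intro notI) (simp add: S_def)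
  then obtain N where n: "n = Suc N" by (cases n) auto
  have root: "p n s = 0" "s > t" if "s \<in> S" for s using that by (auto simp: S_def p_def)
  obtain c where c: "\<exists>s\<in>S. c s \<noteq> 0" "\<And>i. i < m \<Longrightarrow> (\<Sum>s\<in>S. c s * p i s) = 0"
    using exists_nontrivial_relation[OF fin, of m p] card[folded S_def] by blast
  define u where "u i = (\<Sum>s\<in>S. c s * p i s)" for i
  \<comment> \<open>Indices start at \<open>0\<close>, so \<open>u i\<close> is coordinate
    \<open>i + 1\<close> of the combined eigenvector; \<open>v\<close> is the truncated matrix
    applied to it.\<close>
  define v where "v i = (\<Sum>s\<in>S. c s * s * p i s)" for i
  define M where "M s = (\<Sum>i\<le>N. p i s * p i s)" for s
  have Mpos: "M s > 0" for s unfolding M_def p_def by (rule orthpoly_sum_squares_pos)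
  have orth: "(\<Sum>i\<le>N. p i s * p i r) = 0" if "s \<in> S" "r \<in> S" "s \<noteq> r" for s r
  proof -
    have "(s - r) * (\<Sum>i\<le>N. p i s * p i r) = a (Suc N) * (p (Suc N) s * p N r - p N s * p (Suc N) r)"
      unfolding p_def by (rule christoffel_darboux[OF nz])
    then show ?thesis using root(1)[OF that(1)] root(1)[OF that(2)] that(3) n by simp
  qed
  \<comment> \<open>The coefficients \<open>d\<close> are free because two instances are needed:
    \<open>c s\<close> for the norm and \<open>c s * s\<close> for the quadratic form.\<close>
  have uu: "(\<Sum>i\<le>N. u i * (\<Sum>s\<in>S. d s * p i s)) = (\<Sum>s\<in>S. c s * d s * M s)" for d
  proof -
    have "(\<Sum>i\<le>N. u i * (\<Sum>s\<in>S. d s * p i s))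
        = (\<Sum>i\<le>N. \<Sum>s\<in>S. \<Sum>r\<in>S. c s * d r * (p i s * p i r))"
      unfolding u_def by (simp add: sum_product mult_ac)
    also have "\<dots> = (\<Sum>s\<in>S. \<Sum>i\<le>N. \<Sum>r\<in>S. c s * d r * (p i s * p i r))"
      by (rule sum.swap)
    also have "\<dots> = (\<Sum>s\<in>S. \<Sum>r\<in>S. \<Sum>i\<le>N. c s * d r * (p i s * p i r))"
      by (intro sum.cong refl sum.swap)
    also have "\<dots> = (\<Sum>s\<in>S. \<Sum>r\<in>S. c s * d r * (\<Sum>i\<le>N. p i s * p i r))"
      by (simp add: sum_distrib_left)
    also have "\<dots> = (\<Sum>s\<in>S. \<Sum>r\<in>S. if r = s then c s * d s * M s else 0)"
      by (intro sum.cong refl) (auto simp: M_def orth)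
    also have "\<dots> = (\<Sum>s\<in>S. c s * d s * M s)"
      using fin by (simp add: sum.delta)
    finally show ?thesis .
  qed
  have sq: "(\<Sum>i\<le>N. u i * u i) = (\<Sum>s\<in>S. c s * c s * M s)"
    using uu[of c] by (simp add: u_def)
  have qf: "(\<Sum>i\<le>N. u i * v i) = (\<Sum>s\<in>S. c s * (c s * s) * M s)"
    using uu[of "\<lambda>s. c s * s"] by (simp add: v_def)
  have "0 < (\<Sum>s\<in>S. (s - t) * (c s * c s * M s))"
  proof -
    obtain r where r: "r \<in> S" "c r \<noteq> 0" using c(1) by blast
    have "0 < (r - t) * (c r * c r * M r)"
      using root(2)[OF r(1)] r(2) Mpos[of r] by (simp add: zero_less_mult_iff) (metis linorder_neqE_linordered_idom)
    also have "\<dots> = (\<Sum>s\<in>{r}. (s - t) * (c s * c s * M s))" by simp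
    also have "\<dots> \<le> (\<Sum>s\<in>S. (s - t) * (c s * c s * M s))"
      using fin r root(2) Mpos by (intro sum_mono2) (auto intro!: mult_nonneg_nonneg less_imp_le[OF Mpos] simp: less_imp_le)
    finally show ?thesis .
  qed
  also have "\<dots> = (\<Sum>i\<le>N. u i * v i) - t * (\<Sum>i\<le>N. u i * u i)"
    unfolding sq qf by (simp add: sum_distrib_left sum_subtractf[symmetric] algebra_simps)
  finally have strict: "t * (\<Sum>i\<le>N. u i * u i) < (\<Sum>i\<le>N. u i * v i)" by simp
  \<comment> \<open>The value \<open>0\<close> at index \<open>0\<close> cancels the spurious term
    at \<open>i = 0\<close>, where \<open>i - 1\<close> is again \<open>0\<close>.\<close>
  define a' where "a' i = (if i = 0 then 0 else a i)" for i
  have vrec: "v i = a (Suc i) * u (Suc i) + b (Suc i) * u i + a' i * u (i - 1)" for i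
  proof -
    have "s * p i s = a (Suc i) * p (Suc i) s + b (Suc i) * p i s + a' i * p (i - 1) s" for s
    proof (cases i)
      case 0
      have "a (Suc 0) * p (Suc 0) s = s - b (Suc 0)" "p 0 s = 1"
        unfolding p_def by (rule orthpoly_recurrence[OF nz]; assumption)+
      then show ?thesis by (simp add: 0 a'_def)
    next
      case (Suc j)
      have "a (Suc (Suc j)) * p (Suc (Suc j)) s = (s - b (Suc (Suc j))) * p (Suc j) s - a (Suc j) * p j s"
        unfolding p_def by (rule orthpoly_recurrence[OF nz])
      then show ?thesis by (simp add: Suc a'_def algebra_simps)
    qed
    then have "v i = (\<Sum>s\<in>S. c s * (a (Suc i) * p (Suc i) s + b (Suc i) * p i s + a' i * p (i - 1) s))"
      unfolding v_def by (simp add: mult.assoc)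
    also have "\<dots> = a (Suc i) * u (Suc i) + b (Suc i) * u i + a' i * u (i - 1)"
      unfolding u_def by (simp add: distrib_left sum.distrib sum_distrib_left mult.left_commute)
    finally show ?thesis .
  qed
  have un: "u (Suc N) = 0" unfolding u_def using root(1) n by (intro sum.neutral) auto
  \<comment> \<open>Replacing each product of neighbours by the mean of their squares leaves the row
    sum times \<open>u i * u i\<close> and an excess, which in this form telescopes.\<close>
  define g where "g i = a' i * (u i * u i - u (i - 1) * u (i - 1)) / 2" for i
  have am: "x * y \<le> (x * x + y * y) / 2" for x y :: real
    using sum_squares_ge_zero[of "x - y" 0] by (simp add: algebra_simps)
  have a'nn: "a' i \<ge> 0" for i using less_imp_le[OF pos[of i]] by (auto simp: a'_def)
  have term_le: "u i * v i \<le> t * (u i * u i) + (g (Suc i) - g i)" for i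
  proof -
    have "u i * v i = b (Suc i) * (u i * u i) + a' (Suc i) * (u i * u (Suc i)) + a' i * (u i * u (i - 1))"
      by (simp add: vrec a'_def algebra_simps)
    also have "\<dots> \<le> b (Suc i) * (u i * u i) + a' (Suc i) * ((u i * u i + u (Suc i) * u (Suc i)) / 2)
        + a' i * ((u i * u i + u (i - 1) * u (i - 1)) / 2)"
      by (intro add_mono mult_left_mono order_refl am a'nn)
    also have "\<dots> = (b (Suc i) + a' (Suc i) + a' i) * (u i * u i) + (g (Suc i) - g i)"
      by (simp add: g_def field_simps)
    also have "(b (Suc i) + a' (Suc i) + a' i) * (u i * u i) \<le> t * (u i * u i)"
    proof (cases "i < m")
      case True
      then have "u i = 0" unfolding u_def by (rule c(2))
      then show ?thesis by simp
    next
      case False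
      then show ?thesis using form[of "Suc i"] by (intro mult_right_mono) (auto simp: a'_def)
    qed
    finally show ?thesis by simp
  qed
  have "(\<Sum>i\<le>N. u i * v i) \<le> (\<Sum>i\<le>N. t * (u i * u i) + (g (Suc i) - g i))"
    by (rule sum_mono) (rule term_le)
  also have "\<dots> = t * (\<Sum>i\<le>N. u i * u i) + (g (Suc N) - g 0)"
    using sum_telescope[of "\<lambda>i. - g i" N] by (simp add: sum.distrib sum_distrib_left)
  also have "g 0 = 0" by (simp add: g_def a'_def)
  \<comment> \<open>The boundary term has the right sign because \<open>u (Suc N) = 0\<close>, all
    points of \<open>S\<close> being zeros of the polynomial of degree \<open>n\<close>.\<close>
  also have "g (Suc N) \<le> 0"
    using a'nn[of "Suc N"] by (simp add: g_def un mult_nonneg_nonpos)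
  finally show False using strict by simp
qed

text \<open>At most \<open>m\<close> elements exceed \<open>h m\<close>, so the element with exactly
  \<open>m\<close> larger ones is at most \<open>h m\<close>. The induction removes the minimum,
  which is paired with the last index.\<close>

lemma sum_le_of_card_greater:
  fixes S :: "real set" and g :: "real \<Rightarrow> real"
  assumes "finite S"
    and "\<And>m. card {s\<in>S. s > h m} \<le> m"
    and "\<And>x y. x \<in> S \<Longrightarrow> x \<le> y \<Longrightarrow> g x \<le> g y"
  shows "(\<Sum>s\<in>S. g s) \<le> (\<Sum>m<card S. g (h m))"
  using assms
proof (induction "card S" arbitrary: S)
  case 0
  then show ?case by simp
next
  case (Suc n)
  then have ne: "S \<noteq> {}" by auto
  define s0 where "s0 = Min S"
  have s0: "s0 \<in> S" "\<And>s. s \<in> S \<Longrightarrow> s0 \<le> s"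
    using Suc.prems(1) ne by (auto simp: s0_def)
  have "s0 \<le> h n"
  proof (rule ccontr)
    assume "\<not> s0 \<le> h n"
    then have "{s\<in>S. s > h n} = S" using s0(2) by force
    then show False using Suc.prems(2)[of n] Suc.hyps(2) by simp
  qed
  then have le: "g s0 \<le> g (h n)" using Suc.prems(3) s0(1) by blast
  have cS: "card (S - {s0}) = n" using Suc.hyps(2) s0(1) Suc.prems(1) by simp
  have "(\<Sum>s\<in>S - {s0}. g s) \<le> (\<Sum>m<card (S - {s0}). g (h m))"
  proof (rule Suc.hyps(1))
    fix m
    have "card {s \<in> S - {s0}. h m < s} \<le> card {s\<in>S. s > h m}"
      using Suc.prems(1) by (intro card_mono) auto
    then show "card {s \<in> S - {s0}. h m < s} \<le> m" using Suc.prems(2)[of m] by simp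
  qed (use cS Suc.prems in auto)
  then have "(\<Sum>s\<in>S. g s) \<le> (\<Sum>m<n. g (h m)) + g (h n)"
    using le cS sum.remove[OF Suc.prems(1) s0(1), of g] by simp
  then show ?case by (simp add: Suc.hyps(2)[symmetric])
qed

section \<open>Moments of the spectral measure\<close>

lemma ell2_norm_square: "u \<in> ell2 \<Longrightarrow> (ell2_norm u)\<^sup>2 = (\<Sum>n. (cmod (u n))\<^sup>2)"
  unfolding ell2_norm_def ell2_def by (simp add: suminf_nonneg)

lemma ell2_norm_nonneg: "u \<in> ell2 \<Longrightarrow> ell2_norm u \<ge> 0"
  unfolding ell2_norm_def ell2_def by (simp add: suminf_nonneg)

lemma ell2_I:
  assumes "u 0 = 0" "\<And>n. (cmod (u n))\<^sup>2 \<le> f n" "f sums s"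
  shows "u \<in> ell2" "s \<le> K\<^sup>2 \<Longrightarrow> K \<ge> 0 \<Longrightarrow> ell2_norm u \<le> K"
proof -
  have s: "summable (\<lambda>n. (cmod (u n))\<^sup>2)"
    by (rule summable_comparison_test'[OF sums_summable[OF assms(3)], of 0]) (use assms(2) in auto)
  then show "u \<in> ell2" using assms(1) by (simp add: ell2_def)
  assume K: "s \<le> K\<^sup>2" "K \<ge> 0"
  have "(\<Sum>n. (cmod (u n))\<^sup>2) \<le> s"
    using suminf_le[OF assms(2) s sums_summable[OF assms(3)]] sums_unique[OF assms(3)] by simp
  then show "ell2_norm u \<le> K"
    unfolding ell2_norm_def using K by (intro real_le_lsqrt) (auto simp: suminf_nonneg s)
qed

lemma ell2_sums: "u \<in> ell2 \<Longrightarrow> (\<lambda>n. (cmod (u n))\<^sup>2) sums (ell2_norm u)\<^sup>2"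
  using ell2_norm_square[of u] summable_sums[of "\<lambda>n. (cmod (u n))\<^sup>2"] by (simp add: ell2_def)

lemma ell2_scale:
  assumes "u \<in> ell2"
  shows "(\<lambda>n. c * u n) \<in> ell2" "ell2_norm (\<lambda>n. c * u n) \<le> cmod c * ell2_norm u"
proof -
  have 1: "(\<lambda>n. (cmod c)\<^sup>2 * (cmod (u n))\<^sup>2) sums ((cmod c)\<^sup>2 * (ell2_norm u)\<^sup>2)"
    by (rule sums_mult[OF ell2_sums[OF assms]])
  have u0: "c * u 0 = 0" using assms by (simp add: ell2_def)
  show "(\<lambda>n. c * u n) \<in> ell2"
    by (rule ell2_I(1)[where u = "\<lambda>n. c * u n", OF u0 _ 1]) (simp add: norm_mult power_mult_distrib)
  show "ell2_norm (\<lambda>n. c * u n) \<le> cmod c * ell2_norm u"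
    by (rule ell2_I(2)[where u = "\<lambda>n. c * u n", OF u0 _ 1])
      (use ell2_norm_nonneg[OF assms] in \<open>simp_all add: norm_mult power_mult_distrib\<close>)
qed

text \<open>Only boundedness matters, so the crude |x + y|^2 <= 2 (|x|^2 + |y|^2) replaces
  Minkowski's inequality and costs the factor \<open>2\<close>.\<close>

lemma ell2_add:
  assumes "u \<in> ell2" "v \<in> ell2"
  shows "(\<lambda>n. u n + v n) \<in> ell2" "ell2_norm (\<lambda>n. u n + v n) \<le> 2 * (ell2_norm u + ell2_norm v)"
proof -
  have 1: "(\<lambda>n. 2 * ((cmod (u n))\<^sup>2 + (cmod (v n))\<^sup>2)) sums (2 * ((ell2_norm u)\<^sup>2 + (ell2_norm v)\<^sup>2))"
    by (intro sums_mult sums_add ell2_sums assms)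
  have u0: "u 0 + v 0 = 0" using assms by (simp add: ell2_def)
  have le: "(cmod (u n + v n))\<^sup>2 \<le> 2 * ((cmod (u n))\<^sup>2 + (cmod (v n))\<^sup>2)" for n
  proof -
    have "(cmod (u n + v n))\<^sup>2 \<le> (cmod (u n) + cmod (v n))\<^sup>2"
      by (intro power_mono norm_triangle_ineq) auto
    also have "\<dots> \<le> 2 * ((cmod (u n))\<^sup>2 + (cmod (v n))\<^sup>2)" 
      using sum_squares_bound[of "cmod (u n)" "cmod (v n)"] by (simp add: power2_sum)
    finally show ?thesis .
  qed
  show "(\<lambda>n. u n + v n) \<in> ell2"
    by (rule ell2_I(1)[where u = "\<lambda>n. u n + v n", OF u0 le 1])
  have nn: "ell2_norm u \<ge> 0" "ell2_norm v \<ge> 0" using assms by (auto intro: ell2_norm_nonneg)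
  show "ell2_norm (\<lambda>n. u n + v n) \<le> 2 * (ell2_norm u + ell2_norm v)"
  proof (rule ell2_I(2)[where u = "\<lambda>n. u n + v n", OF u0 le 1])
    have "2 * ((ell2_norm u)\<^sup>2 + (ell2_norm v)\<^sup>2) \<le> 4 * ((ell2_norm u)\<^sup>2 + (ell2_norm v)\<^sup>2) + 8 * (ell2_norm u * ell2_norm v)"
      using nn by simp
    then show "2 * ((ell2_norm u)\<^sup>2 + (ell2_norm v)\<^sup>2) \<le> (2 * (ell2_norm u + ell2_norm v))\<^sup>2"
      by (simp add: power2_eq_square algebra_simps)
  qed (use nn in simp)
qed

lemma bounded_opE:
  assumes "bounded_op T"
  obtains C where "C \<ge> 0" "\<And>u. u \<in> ell2 \<Longrightarrow> ell2_norm (T u) \<le> C * ell2_norm u"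
proof -
  obtain C where C: "\<forall>u\<in>ell2. ell2_norm (T u) \<le> C * ell2_norm u"
    using assms unfolding bounded_op_def by blast
  have "ell2_norm (T u) \<le> max 0 C * ell2_norm u" if "u \<in> ell2" for u
    using order_trans[OF bspec[OF C that] mult_right_mono[of C "max 0 C" "ell2_norm u"]] ell2_norm_nonneg[OF that] by simp
  then show thesis by (intro that[of "max 0 C"]) auto
qed

lemma bounded_op_scale: "bounded_op (\<lambda>u n. c * u n)"
proof -
  have "\<exists>C. \<forall>u\<in>ell2. ell2_norm (\<lambda>n. c * u n) \<le> C * ell2_norm u"
    using ell2_scale(2) by blast
  then show ?thesis
    unfolding bounded_op_def using ell2_scale(1) by (auto simp: algebra_simps)
qed

lemma bounded_op_compose:
  assumes "bounded_op S" "bounded_op T"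
  shows "bounded_op (\<lambda>u. S (T u))"
proof -
  obtain C where C: "C \<ge> 0" "\<And>u. u \<in> ell2 \<Longrightarrow> ell2_norm (S u) \<le> C * ell2_norm u"
    using bounded_opE[OF assms(1)] by blast
  obtain D where D: "D \<ge> 0" "\<And>u. u \<in> ell2 \<Longrightarrow> ell2_norm (T u) \<le> D * ell2_norm u"
    using bounded_opE[OF assms(2)] by blast
  have in': "T u \<in> ell2" if "u \<in> ell2" for u using assms(2) that by (simp add: bounded_op_def)
  have "ell2_norm (S (T u)) \<le> C * D * ell2_norm u" if "u \<in> ell2" for u
    using C(2)[OF in'[OF that]] mult_left_mono[OF D(2)[OF that] C(1)] by simp
  then show ?thesis using assms in' unfolding bounded_op_def by auto
qed

lemma bounded_op_add:
  assumes "bounded_op S" "bounded_op T"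
  shows "bounded_op (\<lambda>u n. S u n + T u n)"
proof -
  obtain C where C: "C \<ge> 0" "\<And>u. u \<in> ell2 \<Longrightarrow> ell2_norm (S u) \<le> C * ell2_norm u"
    using bounded_opE[OF assms(1)] by blast
  obtain D where D: "D \<ge> 0" "\<And>u. u \<in> ell2 \<Longrightarrow> ell2_norm (T u) \<le> D * ell2_norm u"
    using bounded_opE[OF assms(2)] by blast
  have in': "T u \<in> ell2" "S u \<in> ell2" if "u \<in> ell2" for u
    using assms that by (simp_all add: bounded_op_def)
  have "ell2_norm (\<lambda>n. S u n + T u n) \<le> 2 * (C + D) * ell2_norm u" if "u \<in> ell2" for u
  proof -
    have "ell2_norm (\<lambda>n. S u n + T u n) \<le> 2 * (ell2_norm (S u) + ell2_norm (T u))"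
      by (intro ell2_add in' that)
    also have "\<dots> \<le> 2 * (C * ell2_norm u + D * ell2_norm u)"
      by (intro mult_left_mono add_mono C D that) auto
    finally show ?thesis by (simp add: algebra_simps)
  qed
  moreover have "(\<lambda>n. S u n + T u n) \<in> ell2" if "u \<in> ell2" for u by (intro ell2_add in' that)
  ultimately have *: "\<exists>C. \<forall>u\<in>ell2. ell2_norm (\<lambda>n. S u n + T u n) \<le> C * ell2_norm u"
    "\<forall>u\<in>ell2. (\<lambda>n. S u n + T u n) \<in> ell2" by blast+
  show ?thesis
    unfolding bounded_op_def using assms * unfolding bounded_op_def by (simp add: algebra_simps)
qed

lemma bounded_op_poly_op:
  assumes "bounded_op A"
  shows "bounded_op (poly_op q A)"
proof (induction q)
  case 0
  have "poly_op 0 A = (\<lambda>u n. 0 * u n)" by (intro ext) (simp add: poly_op_0)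
  then show ?case using bounded_op_scale[of 0] by metis
next
  case (pCons c q)
  have "poly_op (pCons c q) A = (\<lambda>u n. of_real c * u n + poly_op q A (A u) n)"
  proof (intro ext)
    fix u n
    have "pCons c q = smult c 1 + pCons 0 q" by simp
    then show "poly_op (pCons c q) A u n = of_real c * u n + poly_op q A (A u) n"
      by (simp only: poly_op_add poly_op_smult poly_op_1 poly_op_pCons_0)
  qed
  then show ?case
    using bounded_op_add[OF bounded_op_scale bounded_op_compose[OF pCons.IH assms]] by metis
qed

lemma bounded_op_jacobi:
  assumes K: "\<And>n. n \<ge> 1 \<Longrightarrow> \<bar>a n\<bar> \<le> K" "\<And>n. n \<ge> 1 \<Longrightarrow> \<bar>b n\<bar> \<le> K"
  shows "bounded_op (jacobi_op a b)"
proof -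
  have K0: "K \<ge> 0" using K(1)[of 1] by simp
  have key: "jacobi_op a b u \<in> ell2 \<and> ell2_norm (jacobi_op a b u) \<le> (3 * K) * ell2_norm u" if u: "u \<in> ell2" for u
  proof -
    define N where "N = (ell2_norm u)\<^sup>2"
    define f where "f n = (cmod (u n))\<^sup>2" for n
    have f: "f sums N" unfolding f_def N_def by (rule ell2_sums[OF u])
    have u0: "u 0 = 0" using u by (simp add: ell2_def)
    then have f0: "f 0 = 0" by (simp add: f_def)
    have f1: "(\<lambda>n. f (Suc n)) sums N" using f f0 sums_Suc_iff[of f N] by simp
    have f2: "(\<lambda>n. f (n - 1)) sums N" using f f0 sums_Suc_iff[of "\<lambda>n. f (n - 1)" N] by simp
    have s: "(\<lambda>n. 3 * K\<^sup>2 * (f n + f (Suc n) + f (n - 1))) sums (3 * K\<^sup>2 * (N + N + N))"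
      by (intro sums_mult sums_add f f1 f2)
    have le: "(cmod (jacobi_op a b u n))\<^sup>2 \<le> 3 * K\<^sup>2 * (f n + f (Suc n) + f (n - 1))" for n
    proof (cases "n = 0")
      case True
      then show ?thesis by (simp add: jacobi_op_apply f_def)
    next
      case False
      define x y z where "x = cmod (u n)" and "y = cmod (u (Suc n))" and "z = cmod (u (n - 1))"
      have "cmod (jacobi_op a b u n) \<le> cmod (of_real (b n) * u n) + cmod (of_real (a n) * u (Suc n))
         + cmod (if n = 1 then 0 else of_real (a (n - 1)) * u (n - 1))"
        using False by (simp only: jacobi_op_apply if_False) (meson norm_triangle_ineq order_trans add_right_mono)
      also have "\<dots> \<le> K * x + K * y + K * z"
      proof (intro add_mono)
        show "cmod (of_real (b n) * u n) \<le> K * x"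
          using K(2)[of n] False by (simp add: norm_mult x_def mult_right_mono)
        show "cmod (of_real (a n) * u (Suc n)) \<le> K * y"
          using K(1)[of n] False by (simp add: norm_mult y_def mult_right_mono)
        show "cmod (if n = 1 then 0 else of_real (a (n - 1)) * u (n - 1)) \<le> K * z"
          using K(1)[of "n - 1"] False K0 by (auto simp: norm_mult z_def intro!: mult_right_mono)
      qed
      finally have "(cmod (jacobi_op a b u n))\<^sup>2 \<le> (K * x + K * y + K * z)\<^sup>2"
        by (rule power_mono) simp
      also have "\<dots> = K\<^sup>2 * (x + y + z)\<^sup>2" by (simp add: power2_eq_square algebra_simps)
      also have "\<dots> \<le> K\<^sup>2 * (3 * (x\<^sup>2 + y\<^sup>2 + z\<^sup>2))"
      proof (rule mult_left_mono)
        have "0 \<le> (x - y)\<^sup>2 + (y - z)\<^sup>2 + (x - z)\<^sup>2" by simp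
        then show "(x + y + z)\<^sup>2 \<le> 3 * (x\<^sup>2 + y\<^sup>2 + z\<^sup>2)"
          by (simp add: power2_eq_square algebra_simps)
      qed simp
      finally show ?thesis by (simp add: f_def x_def y_def z_def mult.assoc mult.left_commute[of 3])
    qed
    have z: "jacobi_op a b u 0 = 0" by (simp add: jacobi_op_apply)
    have nn: "ell2_norm u \<ge> 0" by (rule ell2_norm_nonneg[OF u])
    have "ell2_norm (jacobi_op a b u) \<le> (3 * K) * ell2_norm u"
      by (rule ell2_I(2)[OF z le s]) (use nn K0 in \<open>simp_all add: N_def power_mult_distrib\<close>)
    then show ?thesis using ell2_I(1)[OF z le s] by blast
  qed
  then show ?thesis
    unfolding bounded_op_def using jacobi_op_add jacobi_op_scale by blast
qed

section \<open>Second moments of the orthonormal polynomials\<close>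

text \<open>A constant sequence is an admissible approximation, so the spectral measure can be
  tested on polynomials without constructing the calculus for other functions.\<close>

lemma continuous_calculus_poly:
  assumes "bounded_op A"
  shows "continuous_calculus A (poly q) (poly_op q A)"
proof -
  have "ell2_norm (\<lambda>n. 0) = 0" by (simp add: ell2_norm_def)
  then have "\<forall>e>0. \<forall>\<^sub>F k in sequentially. \<forall>u\<in>ell2.
      ell2_norm (\<lambda>n. poly_op q A u n - poly_op q A u n) \<le> e * ell2_norm u"
    by (simp add: ell2_norm_nonneg)
  then show ?thesis
    unfolding continuous_calculus_def using bounded_op_poly_op[OF assms]
    by (intro conjI exI[of _ "\<lambda>_. q"] uniform_limit_const) auto
qed

lemma ell2_inner_delta: "ell2_inner (delta k) v = v k"
proof -
  have "(\<Sum>n. cnj (delta k n) * v n) = (\<Sum>n\<in>{k}. cnj (delta k n) * v n)"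
    by (rule suminf_finite) (auto simp: delta_def)
  then show ?thesis by (simp add: ell2_inner_def delta_def)
qed

lemma nn_integral_orthpoly_square:
  fixes a b :: "nat \<Rightarrow> real"
  assumes pos: "\<And>n. n \<ge> 1 \<Longrightarrow> a n > 0"
    and K: "\<And>n. n \<ge> 1 \<Longrightarrow> \<bar>a n\<bar> \<le> K" "\<And>n. n \<ge> 1 \<Longrightarrow> \<bar>b n\<bar> \<le> K"
    and \<nu>: "is_spectral_measure (jacobi_op a b) (delta 1) \<nu>"
  shows "(\<integral>\<^sup>+x. ennreal ((poly (orthpoly a b n) x)\<^sup>2) \<partial>\<nu>) = 1"
proof -
  define S where "S = real_spectrum (jacobi_op a b)"
  define q where "q = orthpoly a b n * orthpoly a b n"
  have "continuous_on S (poly q)" by (intro continuous_intros)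
  moreover have "bounded_op (jacobi_op a b)" by (rule bounded_op_jacobi[OF K])
  ultimately have "ell2_inner (delta 1) (poly_op q (jacobi_op a b) (delta 1)) = of_real (LINT x:S|\<nu>. poly q x)"
    using \<nu> continuous_calculus_poly[where q = q]
    unfolding is_spectral_measure_def S_def by blast
  then have "complex_of_real (LINT x:S|\<nu>. poly q x) = 1"
    unfolding ell2_inner_delta q_def
    using poly_op_orthpoly_square[where a = a and b = b and n = n, OF pos] by simp
  then have L: "(LINT x|\<nu>. indicator S x *\<^sub>R poly q x) = 1"
    by (simp only: of_real_eq_1_iff set_lebesgue_integral_def)
  \<comment> \<open>The Bochner integral of a non-integrable function is \<open>0\<close> by
    convention, so the value \<open>1\<close> itself proves integrability.\<close>
  then have i: "integrable \<nu> (\<lambda>x. indicator S x *\<^sub>R poly q x)"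
    using not_integrable_integral_eq by fastforce
  have "(\<integral>\<^sup>+x. ennreal ((poly (orthpoly a b n) x)\<^sup>2) \<partial>\<nu>) = (\<integral>\<^sup>+x. ennreal (indicator S x *\<^sub>R poly q x) \<partial>\<nu>)"
    by (rule nn_integral_cong_AE)
      (use \<nu> in \<open>auto simp: is_spectral_measure_def S_def q_def power2_eq_square elim!: eventually_mono\<close>)
  also have "\<dots> = 1"
    using nn_integral_eq_integral[OF i] L by (simp add: q_def indicator_def)
  finally show ?thesis .
qed

section \<open>Logarithmic integrals\<close>

text \<open>Here |2 sin (t / 2)| = |1 - exp (i t)|, so this is the logarithm of a distance on the
  unit circle. At the singularities the value is \<open>ln 0 = 0\<close>.\<close>

definition logsin :: "real \<Rightarrow> real" where
  "logsin t = ln \<bar>2 * sin (t / 2)\<bar>"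

text \<open>The antiderivatives below contain the logarithm only in this product. They are thus
  continuous up to the endpoints, and the fundamental theorem asks for a derivative only in the
  interior.\<close>

lemma isCont_x_ln_abs: "isCont (\<lambda>x::real. x * ln \<bar>x\<bar>) x"
proof (cases "x = 0")
  case True
  have "((\<lambda>x::real. x * ln \<bar>x\<bar>) \<longlongrightarrow> 0) (at_right 0)"
    by real_asymp
  moreover have "((\<lambda>x::real. x * ln \<bar>x\<bar>) \<longlongrightarrow> 0) (at_left 0)"
    by real_asymp
  ultimately show ?thesis using True by (simp add: isCont_def filterlim_split_at)
next
  case False
  then show ?thesis by (intro continuous_intros) auto
qed

lemma continuous_on_x_ln_abs [continuous_intros]:
  assumes "continuous_on A f"
  shows "continuous_on A (\<lambda>x. f x * ln \<bar>f x :: real\<bar>)"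
  using continuous_on_compose2[of UNIV "\<lambda>x::real. x * ln \<bar>x\<bar>" A f] isCont_x_ln_abs assms
  by (simp add: continuous_at_imp_continuous_on)

lemma logsin_periodic: "logsin (t + 2 * pi) = logsin t"
  by (simp add: logsin_def add_divide_distrib)

lemma logsin_minus: "logsin (- t) = logsin t"
  by (simp add: logsin_def)

lemma logsin_double: "sin t \<noteq> 0 \<Longrightarrow> logsin (2 * t) = logsin t + logsin (t + pi)"
proof -
  assume s: "sin t \<noteq> 0"
  have "sin t = 2 * sin (t / 2) * cos (t / 2)" using sin_double[of "t / 2"] by simp
  moreover have "sin ((t + pi) / 2) = cos (t / 2)" by (simp add: add_divide_distrib sin_add)
  moreover have "ln (4::real) = 2 * ln 2" using ln_realpow[of 2 2] by simp
  ultimately show ?thesis using s by (simp add: logsin_def abs_mult ln_mult)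
qed

lemma DERIV_logsin:
  assumes "0 < t" "t < 2 * pi"
  shows "(logsin has_real_derivative cos (t / 2) / (2 * sin (t / 2))) (at t)"
proof -
  have s: "sin (t / 2) > 0" using assms by (intro sin_gt_zero) auto
  have "((\<lambda>t. ln (2 * sin (t / 2))) has_real_derivative cos (t / 2) / (2 * sin (t / 2))) (at t)"
    using s by (auto intro!: derivative_eq_intros simp: field_simps)
  moreover have "eventually (\<lambda>t. ln (2 * sin (t / 2)) = logsin t) (nhds t)"
  proof -
    have "eventually (\<lambda>t. t \<in> {0<..<2 * pi}) (nhds t)" using assms by (intro eventually_nhds_in_open) auto
    then show ?thesis
    proof eventually_elim
      case (elim t)
      then have "sin (t / 2) > 0" by (intro sin_gt_zero) auto
      then show ?case by (simp add: logsin_def)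
    qed
  qed
  ultimately show ?thesis by (subst (asm) DERIV_cong_ev[OF refl _ refl]) auto
qed

lemma has_integral_logsin_cos: "((\<lambda>t. logsin t * cos t) has_integral - pi) {0..2 * pi}"
proof -
  \<comment> \<open>Integration by parts: \<open>sin t\<close> times the derivative of
    \<open>logsin\<close> equals \<open>(1 + cos t) / 2\<close>, whose antiderivative is
    subtracted.\<close>
  define G where "G t = sin t * logsin t - (t + sin t) / 2" for t :: real
  have G_eq: "G t = cos (t / 2) * (2 * sin (t / 2) * ln \<bar>2 * sin (t / 2)\<bar>) - (t + sin t) / 2" for t
    using sin_double[of "t / 2"] by (simp add: G_def logsin_def)
  have "((\<lambda>t. logsin t * cos t) has_integral (G (2 * pi) - G 0)) {0..2 * pi}"
  proof (rule fundamental_theorem_of_calculus_interior)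
    show "continuous_on {0..2 * pi} G"
      unfolding G_eq[abs_def] by (intro continuous_intros) auto
    fix t assume t: "t \<in> {0<..<2 * pi}"
    have s: "sin (t / 2) > 0" using t by (intro sin_gt_zero) auto
    have st: "sin t = 2 * sin (t / 2) * cos (t / 2)" "cos t = 2 * (cos (t / 2))\<^sup>2 - 1"
      using sin_double[of "t / 2"] cos_double_cos[of "t / 2"] by simp_all
    have "(logsin has_real_derivative cos (t / 2) / (2 * sin (t / 2))) (at t)"
      using t by (intro DERIV_logsin) auto
    then have "(G has_real_derivative (cos t * logsin t + sin t * (cos (t / 2) / (2 * sin (t / 2)))
       - (1 + cos t) / 2)) (at t)"
      unfolding G_def by (auto intro!: derivative_eq_intros simp: add_divide_distrib mult.commute)
    also have "cos t * logsin t + sin t * (cos (t / 2) / (2 * sin (t / 2))) - (1 + cos t) / 2 = logsin t * cos t"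
    proof -
      have "sin t * (cos (t / 2) / (2 * sin (t / 2))) = (cos (t / 2))\<^sup>2"
        using s unfolding st(1) by (simp add: power2_eq_square)
      moreover have "(1 + cos t) / 2 = (cos (t / 2))\<^sup>2" unfolding st(2) by simp
      ultimately show ?thesis by simp
    qed
    finally show "(G has_vector_derivative logsin t * cos t) (at t)"
      by (simp add: has_real_derivative_iff_has_vector_derivative)
  qed simp
  moreover have "G (2 * pi) - G 0 = - pi" by (simp add: G_def)
  ultimately show ?thesis by simp
qed

lemma has_integral_logsin_sin: "((\<lambda>t. logsin t * sin t) has_integral 0) {0..2 * pi}"
proof -
  \<comment> \<open>By parts with \<open>2 * (sin (t / 2))\<^sup>2\<close> as antiderivative of
    \<open>sin t\<close>; it vanishes at both ends.\<close>
  define G where "G t = sin (t / 2) * (2 * sin (t / 2) * logsin t) - (sin (t / 2))\<^sup>2" for t :: real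
  have "((\<lambda>t. logsin t * sin t) has_integral (G (2 * pi) - G 0)) {0..2 * pi}"
  proof (rule fundamental_theorem_of_calculus_interior)
    show "continuous_on {0..2 * pi} G"
      unfolding G_def logsin_def by (intro continuous_intros) auto
    fix t assume t: "t \<in> {0<..<2 * pi}"
    have s: "sin (t / 2) > 0" using t by (intro sin_gt_zero) auto
    have st: "sin t = 2 * sin (t / 2) * cos (t / 2)"
      using sin_double[of "t / 2"] by simp
    have "(G has_real_derivative (2 * sin (t / 2) * cos (t / 2) * logsin t)) (at t)"
      unfolding G_def using t s
      by (auto intro!: derivative_eq_intros DERIV_logsin simp: field_simps power2_eq_square)
    then show "(G has_vector_derivative logsin t * sin t) (at t)"
      by (simp add: has_real_derivative_iff_has_vector_derivative logsin_def st mult_ac)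
  qed simp
  moreover have "G (2 * pi) - G 0 = 0" by (simp add: G_def)
  ultimately show ?thesis by simp
qed


text \<open>Multiplying by 1 = cos t + 2 sin^2 (t / 2) leaves the integrand already treated and a
  continuous remainder.\<close>

lemma integrable_logsin: "logsin integrable_on {0..2 * pi}"
proof -
  have eq: "logsin t = logsin t * cos t + sin (t / 2) * (2 * sin (t / 2) * ln \<bar>2 * sin (t / 2)\<bar>)" for t
  proof -
    have "cos t = 1 - 2 * (sin (t / 2))\<^sup>2" using cos_double_sin[of "t / 2"] by simp
    then have c: "cos t + 2 * (sin (t / 2))\<^sup>2 = 1" by simp
    have "logsin t * cos t + sin (t / 2) * (2 * sin (t / 2) * ln \<bar>2 * sin (t / 2)\<bar>)
        = logsin t * (cos t + 2 * (sin (t / 2))\<^sup>2)"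
      by (simp add: logsin_def distrib_left power2_eq_square)
    then show ?thesis unfolding c by simp
  qed
  have "(\<lambda>t. sin (t / 2) * (2 * sin (t / 2) * ln \<bar>2 * sin (t / 2)\<bar>)) integrable_on {0..2 * pi}"
    by (intro integrable_continuous_real continuous_intros) auto
  then have "(\<lambda>t. logsin t * cos t + sin (t / 2) * (2 * sin (t / 2) * ln \<bar>2 * sin (t / 2)\<bar>)) integrable_on {0..2 * pi}"
    using has_integral_logsin_cos by (intro integrable_add) (auto simp: integrable_on_def)
  then show ?thesis by (rule integrable_eq) (rule eq[symmetric])
qed

lemma has_integral_translate:
  fixes f :: "real \<Rightarrow> real"
  assumes "(f has_integral i) {a..b}"
  shows "((\<lambda>x. f (x + c)) has_integral i) {a - c..b - c}"
  using has_integral_affinity'[of f i a b 1 c] assms by simp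

text \<open>The duplication formula for the sine turns the integral \<open>I\<close> into \<open>I = 2 I\<close>.\<close>

lemma has_integral_logsin: "(logsin has_integral 0) {0..2 * pi}"
proof -
  define I where "I = integral {0..2 * pi} logsin"
  have I: "(logsin has_integral I) {0..2 * pi}"
    unfolding I_def using integrable_logsin by (rule integrable_integral)
  obtain I1 where I1: "(logsin has_integral I1) {0..pi}"
    using integrable_on_subinterval[OF integrable_logsin, of 0 pi] by (auto simp: integrable_on_def)
  obtain I2 where I2: "(logsin has_integral I2) {pi..2 * pi}"
    using integrable_on_subinterval[OF integrable_logsin, of pi "2 * pi"] by (auto simp: integrable_on_def)
  have I12: "I = I1 + I2"
    using has_integral_combine[OF _ _ I1 I2] I by (simp add: has_integral_unique)
  have "((\<lambda>t. logsin (2 * t)) has_integral I / 2) {0..pi}"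
    using has_integral_affinity'[of logsin I 0 "2 * pi" 2 0] I by simp
  moreover have "((\<lambda>t. logsin (2 * t)) has_integral I1 + I2) {0..pi}"
  proof (rule has_integral_spike_finite)
    have "((\<lambda>t. logsin (t + pi)) has_integral I2) {0..pi}"
      using has_integral_translate[OF I2, of pi] by simp
    then show "((\<lambda>t. logsin t + logsin (t + pi)) has_integral I1 + I2) {0..pi}"
      by (rule has_integral_add[OF I1])
    show "finite {0, pi}" by simp
    show "logsin (2 * t) = logsin t + logsin (t + pi)" if "t \<in> {0..pi} - {0, pi}" for t
      using that sin_gt_zero[of t] by (intro logsin_double) auto
  qed
  ultimately have "I / 2 = I1 + I2" by (rule has_integral_unique)
  then have "I = 0" using I12 by simp
  then show ?thesis using I by simp
qed

lemma ln_abs_cos_diff: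
  assumes "sin ((s - t) / 2) \<noteq> 0" "sin ((s + t) / 2) \<noteq> 0"
  shows "ln \<bar>2 * cos s - 2 * cos t\<bar> = logsin (s - t) + logsin (s + t)"
proof -
  have "2 * cos s - 2 * cos t = - ((2 * sin ((s - t) / 2)) * (2 * sin ((s + t) / 2)))"
    using cos_diff_cos[of t s] unfolding add.commute[of t s] by algebra
  then have "\<bar>2 * cos s - 2 * cos t\<bar> = \<bar>2 * sin ((s - t) / 2)\<bar> * \<bar>2 * sin ((s + t) / 2)\<bar>"
    by (simp only: abs_minus_cancel abs_mult)
  then show ?thesis using assms by (simp only: logsin_def) (subst ln_mult, auto)
qed

lemma has_integral_ln_cos_diff:
  assumes f: "0 \<le> f" "f \<le> pi"
  shows "((\<lambda>t. ln \<bar>2 * cos t - 2 * cos f\<bar> * (1 - cos t)) has_integral pi * cos f) {0..pi}"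
proof -
  \<comment> \<open>The two factors of the cosine difference contribute \<open>h (t - f)\<close> and
    \<open>h (2 * pi - f - t)\<close>. For \<open>t\<close> in \<open>{0..pi}\<close> these
    arguments together sweep one full period, which reduces the integral to the three computed
    above.\<close>
  define h where "h t = logsin t * (1 - cos (t + f))" for t
  have h_period: "h (t + 2 * pi) = h t" for t
  proof -
    have "cos (t + 2 * pi + f) = cos (t + f)" using cos_periodic[of "t + f"] by (simp add: add_ac)
    then show ?thesis by (simp add: h_def logsin_periodic)
  qed
  have "((\<lambda>t. logsin t - cos f * (logsin t * cos t) + sin f * (logsin t * sin t))
      has_integral (0 - cos f * (- pi) + sin f * 0)) {0..2 * pi}"
    by (intro has_integral_add has_integral_diff has_integral_mult_right
        has_integral_logsin has_integral_logsin_cos has_integral_logsin_sin)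
  then have h: "(h has_integral pi * cos f) {0..2 * pi}"
    by (simp add: h_def[abs_def] cos_add algebra_simps)
  then have hint: "h integrable_on {0..2 * pi}" by (rule has_integral_integrable)
  obtain A where A: "(h has_integral A) {0..2 * pi - f}"
    using integrable_on_subinterval[OF hint, of 0 "2 * pi - f"] f by (auto simp: integrable_on_def)
  obtain B where B: "(h has_integral B) {2 * pi - f..2 * pi}"
    using integrable_on_subinterval[OF hint, of "2 * pi - f" "2 * pi"] f by (auto simp: integrable_on_def)
  have AB: "A + B = pi * cos f"
    using has_integral_combine[OF _ _ A B] f h by (simp add: has_integral_unique)
  have "(h has_integral B) {- f..0}"
    using has_integral_translate[OF B, of "2 * pi"] by (simp add: h_period)
  then have full: "(h has_integral pi * cos f) {- f..2 * pi - f}"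
    using has_integral_combine[OF _ _ _ A, of "- f" B] f AB by (simp add: add.commute)
  then have hint': "h integrable_on {- f..2 * pi - f}" by (rule has_integral_integrable)
  obtain C where C: "(h has_integral C) {- f..pi - f}"
    using integrable_on_subinterval[OF hint', of "- f" "pi - f"] f by (auto simp: integrable_on_def)
  obtain D where D: "(h has_integral D) {pi - f..2 * pi - f}"
    using integrable_on_subinterval[OF hint', of "pi - f" "2 * pi - f"] f by (auto simp: integrable_on_def)
  have CD: "C + D = pi * cos f"
    using has_integral_combine[OF _ _ C D] f full by (simp add: has_integral_unique)
  have "((\<lambda>t. h (t - f)) has_integral C) {0..pi}"
    using has_integral_translate[OF C, of "- f"] by simp
  moreover have "((\<lambda>t. h (- t)) has_integral D) {f - 2 * pi..f - pi}"
    using D has_integral_reflect_real[of h D "2 * pi - f" "pi - f"] by simp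
  then have "((\<lambda>t. h (2 * pi - f - t)) has_integral D) {0..pi}"
    using has_integral_translate[of "\<lambda>t. h (- t)" D "f - 2 * pi" "f - pi" "f - 2 * pi"] by (simp add: algebra_simps)
  ultimately have sum: "((\<lambda>t. h (t - f) + h (2 * pi - f - t)) has_integral pi * cos f) {0..pi}"
    using has_integral_add CD by metis
  show ?thesis
  proof (rule has_integral_spike_finite[OF _ _ sum])
    show "finite {f}" by simp
    fix t assume t: "t \<in> {0..pi} - {f}"
    have "cos (2 * pi - t) = cos t" using cos_periodic[of "- t"] by simp
    moreover have "logsin (2 * pi - f - t) = logsin (t + f)"
      using logsin_periodic[of "- (t + f)"] logsin_minus[of "t + f"] by (simp add: algebra_simps)
    moreover have "ln \<bar>2 * cos t - 2 * cos f\<bar> = logsin (t - f) + logsin (t + f)"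
    proof (rule ln_abs_cos_diff)
      show "sin ((t + f) / 2) \<noteq> 0" using t f sin_gt_zero[of "(t + f) / 2"] by auto
      show "sin ((t - f) / 2) \<noteq> 0"
      proof (cases "t > f")
        case True
        then show ?thesis using t f sin_gt_zero[of "(t - f) / 2"] by auto
      next
        case False
        then have "sin ((f - t) / 2) > 0" using t f by (intro sin_gt_zero) auto
        then show ?thesis by (metis less_irrefl minus_diff_eq minus_divide_left neg_equal_0_iff_equal sin_minus)
      qed
    qed
    ultimately show "ln \<bar>2 * cos t - 2 * cos f\<bar> * (1 - cos t) = h (t - f) + h (2 * pi - f - t)"
      by (simp add: h_def algebra_simps)
  qed
qed

text \<open>\<open>C - f\<close> is nonnegative, and a nonnegative gauge integrable function is
  absolutely integrable. This carries the singular logarithmic integrals over to Lebesgue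
  integrals.\<close>

lemma set_integrable_of_has_integral_bounded_above:
  fixes f :: "real \<Rightarrow> real"
  assumes f: "(f has_integral I) {a..b}" "f \<in> borel_measurable borel" "\<And>t. t \<in> {a..b} \<Longrightarrow> f t \<le> C"
  shows "set_integrable lborel {a..b} f" "(LBINT t:{a..b}. f t) = I"
proof -
  have c: "(\<lambda>t. C) absolutely_integrable_on {a..b}"
    by (intro absolutely_integrable_continuous_real continuous_intros)
  have "(\<lambda>t. C - f t) absolutely_integrable_on {a..b}"
    using f(1,3) by (intro nonnegative_absolutely_integrable_1 integrable_diff integrable_const_ivl)
      (auto intro: has_integral_integrable)
  from set_integral_diff(1)[OF c this] have "set_integrable lebesgue {a..b} f" by simp
  then have "integrable lborel (\<lambda>t. indicator {a..b} t *\<^sub>R f t)"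
    unfolding set_integrable_def using f(2) by (subst (asm) integrable_completion) auto
  then show i: "set_integrable lborel {a..b} f" by (simp add: set_integrable_def)
  show "(LBINT t:{a..b}. f t) = I"
    using set_borel_integral_eq_integral(2)[OF i] f(1) by (simp add: integral_unique)
qed

section \<open>Logarithmic potentials for the weight 1 - cos t\<close>

lemma log_potential_inside:
  fixes x :: real
  assumes "-2 \<le> x" "x \<le> 2"
  shows "set_integrable lborel {0..pi} (\<lambda>t. ln \<bar>2 * cos t - x\<bar> * (1 - cos t))"
    "(LBINT t:{0..pi}. ln \<bar>2 * cos t - x\<bar> * (1 - cos t)) = pi * x / 2"
proof -
  have 1: "((\<lambda>t. ln \<bar>2 * cos t - x\<bar> * (1 - cos t)) has_integral pi * (x / 2)) {0..pi}"
    using has_integral_ln_cos_diff[of "arccos (x / 2)"] assms arccos_lbound[of "x / 2"] arccos_ubound[of "x / 2"]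
    by (simp add: cos_arccos)
  have 2: "(\<lambda>t. ln \<bar>2 * cos t - x\<bar> * (1 - cos t)) \<in> borel_measurable borel"
    by measurable
  \<comment> \<open>Two points of [-2, 2] are at most 4 apart, so ln y <= y - 1 gives
    \<open>3\<close>; the weight is at most \<open>2\<close>.\<close>
  have 3: "ln \<bar>2 * cos t - x\<bar> * (1 - cos t) \<le> 3 * 2" if "t \<in> {0..pi}" for t
  proof (cases "\<bar>2 * cos t - x\<bar> = 0")
    case False
    have "ln \<bar>2 * cos t - x\<bar> \<le> \<bar>2 * cos t - x\<bar> - 1" using False by (intro ln_le_minus_one) auto
    also have "\<dots> \<le> 3" using assms cos_le_one[of t] cos_ge_minus_one[of t] by linarith
    finally have "ln \<bar>2 * cos t - x\<bar> * (1 - cos t) \<le> 3 * (1 - cos t)"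
      by (intro mult_right_mono) auto
    also have "\<dots> \<le> 3 * 2" using cos_ge_minus_one[of t] by (intro mult_left_mono) auto
    finally show ?thesis .
  qed simp
  from set_integrable_of_has_integral_bounded_above[OF 1 2 3]
  show "set_integrable lborel {0..pi} (\<lambda>t. ln \<bar>2 * cos t - x\<bar> * (1 - cos t))"
    "(LBINT t:{0..pi}. ln \<bar>2 * cos t - x\<bar> * (1 - cos t)) = pi * x / 2" by simp_all
qed

lemma set_integrable_log_potential:
  "set_integrable lborel {0..pi} (\<lambda>t. ln \<bar>2 * cos t - x\<bar> * (1 - cos t))"
proof (cases "-2 \<le> x \<and> x \<le> 2")
  case True
  then show ?thesis by (intro log_potential_inside) auto
next
  case False
  have "2 * cos t - x \<noteq> 0" for t
    using False cos_le_one[of t] cos_ge_minus_one[of t] by auto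
  then show ?thesis
    by (intro borel_integrable_compact[where 'a = real and 'b = real, unfolded set_integrable_def[symmetric]] continuous_intros) auto
qed

text \<open>The derivative \<open>g\<close> of \<open>4 * sqrt (sin (t / 2))\<close> has the right
  singularity but an extra factor \<open>cos (t / 2)\<close>. Where \<open>sin (t / 2)\<close> is
  below \<open>1 / 4\<close> this factor is at least \<open>1 / 2\<close>; elsewhere the constant
  \<open>2\<close> suffices.\<close>

lemma set_integrable_inverse_sqrt_sin:
  "set_integrable lborel {0..pi} (\<lambda>t. 1 / sqrt (sin (t / 2)))"
proof -
  define g where "g t = cos (t / 2) / sqrt (sin (t / 2))" for t :: real
  have "(g has_integral (4 * sqrt (sin (pi / 2)) - 4 * sqrt (sin (0 / 2)))) {0..pi}"
  proof (rule fundamental_theorem_of_calculus_interior)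
    show "continuous_on {0..pi} (\<lambda>t. 4 * sqrt (sin (t / 2)))" by (intro continuous_intros) auto
    fix t assume t: "t \<in> {0<..<pi}"
    have s: "sin (t / 2) > 0" using t by (intro sin_gt_zero) auto
    have "((\<lambda>t. 4 * sqrt (sin (t / 2))) has_real_derivative 4 * (cos (t / 2) * (1 / 2) * (inverse (sqrt (sin (t / 2))) / 2))) (at t)"
      using s by (auto intro!: derivative_eq_intros)
    also have "4 * (cos (t / 2) * (1 / 2) * (inverse (sqrt (sin (t / 2))) / 2)) = g t"
      by (simp add: g_def field_simps)
    finally show "((\<lambda>t. 4 * sqrt (sin (t / 2))) has_vector_derivative g t) (at t)"
      by (simp add: has_real_derivative_iff_has_vector_derivative)
  qed simp
  then have g_int: "g integrable_on {0..pi}" by (rule has_integral_integrable)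
  have s0: "sin (t / 2) \<ge> 0" "cos (t / 2) \<ge> 0" if "t \<in> {0..pi}" for t
    using that by (auto intro!: sin_ge_zero cos_ge_zero)
  have g0: "g t \<ge> 0" if "t \<in> {0..pi}" for t using s0[OF that] by (simp add: g_def)
  have "(\<lambda>t. 2 * g t + 2) absolutely_integrable_on {0..pi}"
    using g_int g0 by (intro nonnegative_absolutely_integrable_1 integrable_add integrable_const_ivl integrable_on_mult_right)
      (auto intro!: add_nonneg_nonneg)
  then have "set_integrable lborel {0..pi} (\<lambda>t. 2 * g t + 2)"
    unfolding set_integrable_def g_def by (subst (asm) integrable_completion) (auto, measurable)
  then show ?thesis
  proof (rule set_integrable_bound)
    show "AE t in lborel. t \<in> {0..pi} \<longrightarrow> norm (1 / sqrt (sin (t / 2))) \<le> norm (2 * g t + 2)"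
    proof (intro AE_I2 impI)
      fix t :: real assume t: "t \<in> {0..pi}"
      define s where "s = sin (t / 2)"
      have s: "s \<ge> 0" "cos (t / 2) \<ge> 0" using s0[OF t] by (auto simp: s_def)
      have "1 / sqrt s \<le> 2 * (cos (t / 2) / sqrt s) + 2"
      proof (cases "s \<ge> 1 / 4")
        case True
        then have "sqrt s \<ge> sqrt (1 / 4)" by (intro real_sqrt_le_mono)
        then have "sqrt s \<ge> 1 / 2" by (simp add: real_sqrt_divide)
        moreover from this have "sqrt s > 0" by linarith
        ultimately have "1 / sqrt s \<le> 2" by (simp add: field_simps)
        then show ?thesis using s by (smt (verit) divide_nonneg_nonneg real_sqrt_ge_zero)
      next
        case False
        have "(cos (t / 2))\<^sup>2 = 1 - s\<^sup>2" by (simp add: s_def cos_squared_eq)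
        moreover have "s\<^sup>2 \<le> (1 / 4)\<^sup>2" using s False by (intro power_mono) auto
        ultimately have "(1 / 2)\<^sup>2 \<le> (cos (t / 2))\<^sup>2" by (simp add: power2_eq_square)
        then have "1 / 2 \<le> cos (t / 2)" by (rule power2_le_imp_le[OF _ s(2)])
        then have "1 \<le> 2 * cos (t / 2)" by simp
        then have "1 / sqrt s \<le> 2 * cos (t / 2) / sqrt s" using s by (intro divide_right_mono) auto
        then show ?thesis by simp
      qed
      then show "norm (1 / sqrt (sin (t / 2))) \<le> norm (2 * g t + 2)"
        using s g0[OF t] by (simp add: g_def s_def)
    qed
  qed (auto simp: set_borel_measurable_def)
qed

text \<open>An exponent p must exceed 1 for the costs (C / j)^p to be summable, and stay below 3 / 2
  for the error c (d / c)^p, with c of order t^2, to be integrable at 0. The choice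
  \<open>5 / 4\<close> lies in between.\<close>

lemma ln_one_plus_lower:
  fixes y :: real
  assumes "y \<ge> 0"
  shows "ln (1 + y) \<ge> y - y powr (5 / 4)"
proof (cases "y \<le> 1")
  case True
  have "y powr 2 \<le> y powr (5 / 4)"
  proof (cases "y = 0")
    case False
    then show ?thesis using True assms by (intro powr_mono') auto
  qed simp
  moreover have "y powr 2 = y\<^sup>2" using assms by (cases "y = 0") (simp_all add: powr_numeral)
  ultimately show ?thesis using ln_one_plus_pos_lower_bound[OF assms True] by linarith
next
  case False
  then have "y powr 1 \<le> y powr (5 / 4)" by (intro powr_mono) auto
  then have "y \<le> y powr (5 / 4)" using assms by simp
  moreover have "ln (1 + y) \<ge> 0" using assms by simp
  ultimately show ?thesis by linarith
qed

lemma log_potential_lower: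
  "\<exists>C\<ge>0. \<forall>x. pi * x / 2 - C * max 0 (x - 2) powr (5 / 4)
      \<le> (LBINT t:{0..pi}. ln \<bar>2 * cos t - x\<bar> * (1 - cos t))"
proof -
  define J where "J = (LBINT t:{0..pi}. 1 / sqrt (sin (t / 2)))"
  have J0: "J \<ge> 0" unfolding J_def set_lebesgue_integral_def
    by (intro Bochner_Integration.integral_nonneg) (auto simp: indicator_def intro!: sin_ge_zero)
  have "pi * x / 2 - J * max 0 (x - 2) powr (5 / 4)
      \<le> (LBINT t:{0..pi}. ln \<bar>2 * cos t - x\<bar> * (1 - cos t))" for x :: real
  proof -
    consider "x < -2" | "-2 \<le> x \<and> x \<le> 2" | "x > 2" by linarith
    then show ?thesis
    proof cases
      case 1
      \<comment> \<open>To the left of -2 the potential grows while \<open>pi * x / 2\<close> falls,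
        so comparison with the point -2 suffices.\<close>
      have "pi * x \<le> pi * (-2)" using 1 by (intro mult_left_mono) auto
      then have "pi * x / 2 - J * max 0 (x - 2) powr (5 / 4) \<le> pi * (-2) / 2" using 1 by simp
      also have "\<dots> = (LBINT t:{0..pi}. ln \<bar>2 * cos t - (-2)\<bar> * (1 - cos t))"
        by (rule log_potential_inside(2)[symmetric]) auto
      also have "\<dots> \<le> (LBINT t:{0..pi}. ln \<bar>2 * cos t - x\<bar> * (1 - cos t))"
      proof (rule set_integral_mono_AE)
        \<comment> \<open>At \<open>t = pi\<close> the smaller side contains
          \<open>ln 0 = 0\<close>, for which monotonicity of the logarithm fails; that point is
          discarded.\<close>
        show "AE t\<in>{0..pi} in lborel. ln \<bar>2 * cos t - (-2)\<bar> * (1 - cos t) \<le> ln \<bar>2 * cos t - x\<bar> * (1 - cos t)"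
          using AE_lborel_singleton[of pi]
        proof eventually_elim
          case (elim t)
          show ?case
          proof
            assume t: "t \<in> {0..pi}"
            have "cos pi < cos t" using t elim by (intro cos_monotone_0_pi) auto
            then have "ln \<bar>2 * cos t - (-2)\<bar> \<le> ln \<bar>2 * cos t - x\<bar>" using 1 by simp
            then show "ln \<bar>2 * cos t - (-2)\<bar> * (1 - cos t) \<le> ln \<bar>2 * cos t - x\<bar> * (1 - cos t)"
              by (rule mult_right_mono) simp
          qed
        qed
      qed (rule set_integrable_log_potential)+
      finally show ?thesis .
    next
      case 2
      then show ?thesis using log_potential_inside(2)[of x] by simp
    next
      case 3
      define d where "d = x - 2"
      have d: "d > 0" using 3 by (simp add: d_def)
      have i1: "set_integrable lborel {0..pi} (\<lambda>t. ln \<bar>2 * cos t - 2\<bar> * (1 - cos t))"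
        and i2: "set_integrable lborel {0..pi} (\<lambda>t. d / 2)"
        and i3: "set_integrable lborel {0..pi} (\<lambda>t. d powr (5 / 4) * (1 / sqrt (sin (t / 2))))"
        by (rule set_integrable_log_potential, simp add: set_integrable_def,
            rule set_integrable_mult_right, rule set_integrable_inverse_sqrt_sin)
      \<comment> \<open>The integral of \<open>d / 2\<close> continues the formula at
        \<open>x = 2\<close> linearly; the last term pays for linearizing the logarithm.\<close>
      have "pi * x / 2 - J * max 0 (x - 2) powr (5 / 4) = pi * 2 / 2 + pi * d / 2 - d powr (5 / 4) * J"
        using d by (simp add: d_def max_def field_simps)
      also have "\<dots> = (LBINT t:{0..pi}. ln \<bar>2 * cos t - 2\<bar> * (1 - cos t) + d / 2 - d powr (5 / 4) * (1 / sqrt (sin (t / 2))))"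
        using log_potential_inside(2)[of 2] i1 i2 i3 unfolding J_def
        by (subst set_integral_diff(2), simp, simp, subst set_integral_add(2), simp, simp, subst set_integral_mult_right)
          (simp add: set_integral_const)
      also have "\<dots> \<le> (LBINT t:{0..pi}. ln \<bar>2 * cos t - x\<bar> * (1 - cos t))"
      proof (rule set_integral_mono_AE)
        show "AE t\<in>{0..pi} in lborel. ln \<bar>2 * cos t - 2\<bar> * (1 - cos t) + d / 2 - d powr (5 / 4) * (1 / sqrt (sin (t / 2)))
            \<le> ln \<bar>2 * cos t - x\<bar> * (1 - cos t)"
          using AE_lborel_singleton[of "0::real"]
        proof eventually_elim
          case (elim t)
          show ?case
          proof
            assume t: "t \<in> {0..pi}"
            \<comment> \<open>\<open>y\<close> is the relative growth of the distance |2 cos t - x|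
              as \<open>x\<close> moves from 2 to 2 + \<open>d\<close>. The product
              \<open>c * y = d / 2\<close> is independent of \<open>t\<close>.\<close>
            define s c y where "s = sin (t / 2)" and "c = 1 - cos t" and "y = d / (2 * c)"
            have s: "s > 0" using t elim unfolding s_def by (intro sin_gt_zero) auto
            have cs: "c = 2 * s\<^sup>2" using cos_double_sin[of "t / 2"] by (simp add: c_def s_def)
            have c: "c > 0" using s by (simp add: cs)
            have y: "y > 0" using c d by (simp add: y_def)
            \<comment> \<open>As \<open>c = 2 * s\<^sup>2\<close>, the powers of \<open>s\<close>
              combine to s^(2 - 5/2), the inverse square root integrated in
              \<open>J\<close>.\<close>
            have "c * y powr (5 / 4) \<le> d powr (5 / 4) * (1 / sqrt s)"
            proof -
              have half: "A / 2 \<le> A" if "0 \<le> A" for A :: real using that by simp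
              have nn: "0 \<le> d powr (5 / 4) * (1 / sqrt (2 * s))" using s by simp
              have e: "2 * c = (2 * s) powr 2" using s by (simp add: cs powr_numeral power2_eq_square)
              have "y powr (5 / 4) = d powr (5 / 4) / (2 * s) powr (5 / 2)"
                using d s by (simp only: y_def e powr_divide powr_powr) (simp add: powr_divide powr_powr)
              then have "c * y powr (5 / 4) = d powr (5 / 4) * ((2 * s) powr 2 / (2 * s) powr (5 / 2)) / 2"
                unfolding e[symmetric] by simp
              also have "(2 * s) powr 2 / (2 * s) powr (5 / 2) = (2 * s) powr (- (1 / 2))"
                by (simp add: powr_diff[symmetric])
              also have "\<dots> = 1 / sqrt (2 * s)" using s by (simp add: powr_minus_divide powr_half_sqrt)
              also have "d powr (5 / 4) * (1 / sqrt (2 * s)) / 2 \<le> d powr (5 / 4) * (1 / sqrt (2 * s))"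
                using half[OF nn] .
              also have "\<dots> \<le> d powr (5 / 4) * (1 / sqrt s)"
                using s by (intro mult_left_mono divide_left_mono) auto
              finally show ?thesis .
            qed
            moreover have "c * (y - y powr (5 / 4)) \<le> c * ln (1 + y)"
              using ln_one_plus_lower[of y] y c by (intro mult_left_mono) auto
            moreover have "c * y = d / 2" using c by (simp add: y_def)
            ultimately have "d / 2 - d powr (5 / 4) * (1 / sqrt s) \<le> c * ln (1 + y)"
              by (simp add: right_diff_distrib)
            moreover have "ln \<bar>2 * cos t - 2\<bar> * c + c * ln (1 + y) = ln \<bar>2 * cos t - x\<bar> * c"
            proof -
              have e1: "\<bar>2 * cos t - 2\<bar> = 2 * c" using c by (simp add: c_def)
              have e2: "\<bar>2 * cos t - x\<bar> = 2 * c * (1 + y)"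
              proof -
                have "2 * c * (1 + y) = 2 * c + d" using c by (simp add: y_def distrib_left)
                also have "\<dots> = x - 2 * cos t" by (simp add: c_def d_def)
                finally show ?thesis using c d by (simp add: c_def d_def)
              qed
              have "ln (2 * c * (1 + y)) = ln (2 * c) + ln (1 + y)" using c y by (subst ln_mult) auto
              then show ?thesis unfolding e1 e2 by (simp only: distrib_right mult.commute[of c])
            qed
            ultimately show "ln \<bar>2 * cos t - 2\<bar> * (1 - cos t) + d / 2 - d powr (5 / 4) * (1 / sqrt (sin (t / 2)))
              \<le> ln \<bar>2 * cos t - x\<bar> * (1 - cos t)"
              unfolding c_def[symmetric] s_def[symmetric] by linarith
          qed
        qed
      qed (use i1 i2 i3 in \<open>auto intro!: set_integral_diff set_integral_add set_integrable_log_potential\<close>)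
      finally show ?thesis .
    qed
  qed
  then show ?thesis using J0 by blast
qed

section \<open>Changes of variable\<close>

lemma nn_integral_cos_substitution:
  fixes f :: "real \<Rightarrow> ennreal"
  assumes [measurable]: "f \<in> borel_measurable borel"
  shows "(\<integral>\<^sup>+E\<in>{-2<..<2}. f E \<partial>lborel) = (\<integral>\<^sup>+t\<in>{0..pi}. f (2 * cos t) * ennreal (2 * sin t) \<partial>lborel)"
proof -
  \<comment> \<open>The substitution rule wants a nonnegative derivative, so it is applied to
    \<open>- 2 * cos t\<close> and followed by a reflection.\<close>
  have "(\<integral>\<^sup>+E. f (- E) * indicator {- 2 * cos 0..- 2 * cos pi} E \<partial>lborel)
      = (\<integral>\<^sup>+t. f (- (- 2 * cos t)) * ennreal (2 * sin t) * indicator {0..pi} t \<partial>lborel)"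
    by (rule nn_integral_substitution_aux)
      (auto intro!: derivative_eq_intros continuous_intros sin_ge_zero)
  moreover have "(\<integral>\<^sup>+E. f (- E) * indicator {- 2 * cos 0..- 2 * cos pi} E \<partial>lborel)
      = (\<integral>\<^sup>+E. f E * indicator {-2..2} E \<partial>lborel)"
  proof -
    have "(\<integral>\<^sup>+E. f E * indicator {-2..2} E \<partial>lborel) = (\<integral>\<^sup>+E. f (- E) * indicator {-2..2} (- E) \<partial>lborel)"
      using nn_integral_real_affine[of "\<lambda>E. f E * indicator {-2..2} E" "-1" 0] by simp
    also have "\<dots> = (\<integral>\<^sup>+E. f (- E) * indicator {- 2 * cos 0..- 2 * cos pi} E \<partial>lborel)"
      by (intro nn_integral_cong) (auto simp: indicator_def)
    finally show ?thesis ..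
  qed
  moreover have "(\<integral>\<^sup>+E. f E * indicator {-2..2} E \<partial>lborel) = (\<integral>\<^sup>+E\<in>{-2<..<2}. f E \<partial>lborel)"
    using AE_lborel_singleton[of "2::real"] AE_lborel_singleton[of "-2::real"]
    by (intro nn_integral_cong_AE) (auto simp: indicator_def)
  ultimately show ?thesis by simp
qed


lemma nn_integral_reflect:
  fixes f :: "real \<Rightarrow> ennreal"
  assumes [measurable]: "f \<in> borel_measurable borel"
  shows "(\<integral>\<^sup>+E\<in>{-c<..<c}. f (- E) \<partial>lborel) = (\<integral>\<^sup>+E\<in>{-c<..<c}. f E \<partial>lborel)"
proof -
  have "(\<integral>\<^sup>+E\<in>{-c<..<c}. f E \<partial>lborel) = (\<integral>\<^sup>+E. f (- E) * indicator {-c<..<c} (- E) \<partial>lborel)"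
    using nn_integral_real_affine[of "\<lambda>E. f E * indicator {-c<..<c} E" "-1" 0] by simp
  also have "\<dots> = (\<integral>\<^sup>+E\<in>{-c<..<c}. f (- E) \<partial>lborel)"
    by (intro nn_integral_cong) (auto simp: indicator_def)
  finally show ?thesis ..
qed

section \<open>Divergence of the Szego integral\<close>

lemma LBINT_one_minus_cos:
  "set_integrable lborel {0..pi} (\<lambda>t. 1 - cos t)" "(LBINT t:{0..pi}. 1 - cos t) = pi"
proof -
  have "((\<lambda>t. 1 - cos t) has_integral ((pi - sin pi) - (0 - sin 0))) {0..pi}"
    by (rule fundamental_theorem_of_calculus)
      (auto intro!: derivative_eq_intros simp: has_real_derivative_iff_has_vector_derivative[symmetric])
  then have 1: "((\<lambda>t. 1 - cos t) has_integral pi) {0..pi}" by simp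
  have 2: "(\<lambda>t::real. 1 - cos t) \<in> borel_measurable borel" by measurable
  have 3: "1 - cos t \<le> 2" if "t \<in> {0..pi}" for t using cos_ge_minus_one[of t] by linarith
  from set_integrable_of_has_integral_bounded_above[OF 1 2 3]
  show "set_integrable lborel {0..pi} (\<lambda>t. 1 - cos t)" "(LBINT t:{0..pi}. 1 - cos t) = pi"
    by simp_all
qed

lemma set_integral_sum:
  fixes f :: "'i \<Rightarrow> 'a \<Rightarrow> real"
  assumes "finite I" and "\<And>i. i \<in> I \<Longrightarrow> set_integrable M A (f i)"
  shows "set_integrable M A (\<lambda>x. \<Sum>i\<in>I. f i x)"
    "set_lebesgue_integral M A (\<lambda>x. \<Sum>i\<in>I. f i x) = (\<Sum>i\<in>I. set_lebesgue_integral M A (f i))"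
proof -
  have f: "integrable M (\<lambda>x. indicat_real A x *\<^sub>R f i x)" if "i \<in> I" for i
    using assms(2)[OF that] by (simp only: set_integrable_def)
  show "set_integrable M A (\<lambda>x. \<Sum>i\<in>I. f i x)"
    unfolding set_integrable_def scaleR_sum_right by (rule Bochner_Integration.integrable_sum) (rule f)
  show "set_lebesgue_integral M A (\<lambda>x. \<Sum>i\<in>I. f i x) = (\<Sum>i\<in>I. set_lebesgue_integral M A (f i))"
    unfolding set_lebesgue_integral_def scaleR_sum_right by (rule Bochner_Integration.integral_sum) (rule f)
qed

text \<open>Jensen's inequality for \<open>\<integral> p\<^sub>n\<^sup>2 W dt \<le> 1\<close> and the measure \<open>(1 - cos t) dt\<close>, in the form
  \<open>ln y \<le> y\<close>.\<close>

lemma sum_log_potential_le: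
  fixes a b :: "nat \<Rightarrow> real" and W :: "real \<Rightarrow> real"
  assumes pos: "\<And>n. n \<ge> 1 \<Longrightarrow> a n > 0"
    and W [measurable]: "W \<in> borel_measurable borel" and W0: "\<And>t. W t \<ge> 0"
    and Wpos: "AE t\<in>{0..pi} in lborel. W t > 0"
    and Wint: "set_integrable lborel {0..pi} (\<lambda>t. ln (sin t / (pi * W t)))"
    and bound: "(\<integral>\<^sup>+t\<in>{0..pi}. ennreal ((poly (orthpoly a b n) (2 * cos t))\<^sup>2 * (W t * (2 * sin t))) \<partial>lborel) \<le> 1"
  shows "2 * (\<Sum>s\<in>{x. poly (orthpoly a b n) x = 0}. (LBINT t:{0..pi}. ln \<bar>2 * cos t - s\<bar> * (1 - cos t)))
      \<le> 2 * pi * (\<Sum>k=1..n. ln (a k)) + 2 * pi + (LBINT t:{0..pi}. ln (sin t / (pi * W t)) * (1 - cos t))"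
proof -
  define S where "S = {x. poly (orthpoly a b n) x = 0}"
  note fac = orthpoly_factorization[where a = a and b = b and n = n, OF pos, folded S_def]
  have fin: "finite S" using fac(1) by simp
  define A where "A = (\<Prod>k=1..n. a k)"
  have A: "A > 0" unfolding A_def by (intro prod_pos) (auto intro: pos)
  have lnA: "ln A = (\<Sum>k=1..n. ln (a k))" unfolding A_def using pos by (intro ln_prod) (auto, metis less_irrefl)
  define q where "q t = poly (orthpoly a b n) (2 * cos t)" for t
  have q_prod: "q t = (\<Prod>s\<in>S. 2 * cos t - s) / A" for t
    unfolding q_def A_def using fac(4) by simp
  have [measurable]: "q \<in> borel_measurable borel"
    unfolding q_prod[abs_def] by measurable
  define l where "l s t = ln \<bar>2 * cos t - s\<bar> * (1 - cos t)" for s t :: real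
  have l_int: "set_integrable lborel {0..pi} (l s)" for s
    unfolding l_def[abs_def] by (rule set_integrable_log_potential)
  define L where "L t = 2 * (\<Sum>s\<in>S. l s t) - 2 * ln A * (1 - cos t)" for t
  have L_int: "set_integrable lborel {0..pi} L"
    "(LBINT t:{0..pi}. L t) = 2 * (\<Sum>s\<in>S. LBINT t:{0..pi}. l s t) - 2 * ln A * pi"
    unfolding L_def[abs_def] using set_integral_sum[OF fin, of lborel "{0..pi}" l, OF l_int] LBINT_one_minus_cos
    by simp_all
  define w where "w t = (q t)\<^sup>2 * (W t * (2 * sin t))" for t
  have w_int: "set_integrable lborel {0..pi} w" "(LBINT t:{0..pi}. w t) \<le> 1"
  proof -
    have nn: "0 \<le> indicator {0..pi} t *\<^sub>R w t" for t
      using W0[of t] by (auto simp: w_def indicator_def intro!: mult_nonneg_nonneg sin_ge_zero)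
    have m: "(\<lambda>t. indicator {0..pi} t *\<^sub>R w t) \<in> borel_measurable lborel"
      unfolding w_def[abs_def] by measurable
    have e: "(\<integral>\<^sup>+t. ennreal (indicator {0..pi} t *\<^sub>R w t) \<partial>lborel) \<le> 1"
    proof -
      have "(\<integral>\<^sup>+t. ennreal (indicator {0..pi} t *\<^sub>R w t) \<partial>lborel) = (\<integral>\<^sup>+t\<in>{0..pi}. ennreal (w t) \<partial>lborel)"
        by (intro nn_integral_cong) (auto simp: indicator_def)
      then show ?thesis using bound by (simp add: w_def q_def)
    qed
    then show "set_integrable lborel {0..pi} w"
      unfolding set_integrable_def using nn m by (intro integrableI_nonneg) (auto simp: order_le_less_trans)
    show "(LBINT t:{0..pi}. w t) \<le> 1"
      unfolding set_lebesgue_integral_def using nn m e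
      by (subst integral_eq_nn_integral) (auto simp: enn2real_leI)
  qed
  define v where "v t = ln (sin t / (pi * W t)) * (1 - cos t)" for t
  have v_int: "set_integrable lborel {0..pi} v"
  proof (rule set_integrable_bound)
    show "set_integrable lborel {0..pi} (\<lambda>t. 2 * ln (sin t / (pi * W t)))"
      using Wint by simp
    show "set_borel_measurable lborel {0..pi} v"
      unfolding set_borel_measurable_def v_def[abs_def] by measurable
    have "\<bar>ln (sin t / (pi * W t))\<bar> * \<bar>1 - cos t\<bar> \<le> \<bar>ln (sin t / (pi * W t))\<bar> * 2" for t
      using cos_ge_minus_one[of t] cos_le_one[of t] by (intro mult_left_mono) auto
    then show "AE t in lborel. t \<in> {0..pi} \<longrightarrow> norm (v t) \<le> norm (2 * ln (sin t / (pi * W t)))"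
      by (simp add: v_def abs_mult mult.commute)
  qed
  have "(LBINT t:{0..pi}. L t) \<le> (LBINT t:{0..pi}. pi * w t + v t - l (-2) t)"
  proof (rule set_integral_mono_AE)
    \<comment> \<open>At a zero of \<open>q\<close> the convention \<open>ln 0 = 0\<close> destroys
      the formula for the logarithm of the product; these points form a null set.\<close>
    have "finite {t\<in>{0..pi}. q t = 0}"
    proof -
      have "q t = 0 \<Longrightarrow> 2 * cos t \<in> S" for t by (simp add: q_def S_def)
      then have "{t\<in>{0..pi}. q t = 0} \<subseteq> arccos ` ((\<lambda>x. x / 2) ` S)"
        by (force simp: image_iff arccos_cos)
      then show ?thesis using fin by (meson finite_imageI finite_subset)
    qed
    then have "{t\<in>{0..pi}. q t = 0} \<in> null_sets lborel" by (rule finite_imp_null_set_lborel)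
    then have "AE t in lborel. t \<notin> {t\<in>{0..pi}. q t = 0}" by (rule AE_not_in)
    then show "AE t\<in>{0..pi} in lborel. L t \<le> pi * w t + v t - l (-2) t"
      using Wpos AE_lborel_singleton[of "0::real"] AE_lborel_singleton[of pi]
    proof eventually_elim
      case (elim t)
      show ?case
      proof
        assume t: "t \<in> {0..pi}"
        then have qt: "q t \<noteq> 0" and Wt: "W t > 0" and s: "sin t > 0" and t0: "0 < t" "t < pi"
          using elim by (auto intro!: sin_gt_zero)
        define c where "c = 1 - cos t"
        have "cos t < cos 0" using t0 by (intro cos_monotone_0_pi) auto
        then have c: "c > 0" by (simp add: c_def)
        have "cos pi < cos t" using t0 by (intro cos_monotone_0_pi) auto
        then have c2: "1 + cos t > 0" by simp
        \<comment> \<open>Chosen so that \<open>c * R\<close> is \<open>pi\<close> times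
          \<open>W t * (2 * sin t)\<close>: multiplied by \<open>c\<close>, the bound ln y <= y at y
          = q^2 R produces the integrand whose integral is at most 1.\<close>
        define R where "R = 2 * pi * W t * sin t / c"
        have R: "R > 0" using Wt s c by (simp add: R_def)
        have nz: "2 * cos t - r \<noteq> 0" if "r \<in> S" for r
          using qt fin that by (auto simp: q_prod)
        have "ln \<bar>q t\<bar> = (\<Sum>r\<in>S. ln \<bar>2 * cos t - r\<bar>) - ln A"
          using A nz fin by (simp add: q_prod abs_divide ln_div prod_pos abs_prod ln_prod)
        then have "2 * (c * ln \<bar>q t\<bar>) = 2 * (c * ((\<Sum>r\<in>S. ln \<bar>2 * cos t - r\<bar>) - ln A))" by simp
        also have "\<dots> = L t"
          unfolding L_def l_def c_def[symmetric]
          by (simp add: right_diff_distrib sum_distrib_left[symmetric] sum_distrib_right[symmetric] mult_ac)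
        finally have L: "L t = 2 * (c * ln \<bar>q t\<bar>)" ..
        have sq: "sin t * sin t = c * (1 + cos t)"
          using sin_squared_eq[of t] by (simp add: c_def power2_eq_square algebra_simps)
        \<comment> \<open>This splits ln R into the potential at -2, known exactly, and the Szego
          integrand.\<close>
        have "R = (2 * cos t - (-2)) / (sin t / (pi * W t))"
        proof -
          have "(2 * cos t - (-2)) / (sin t / (pi * W t)) = 2 * pi * W t * (1 + cos t) / sin t"
            using s Wt by (simp add: field_simps)
          also have "\<dots> = 2 * pi * W t * (sin t * sin t) / (c * sin t)" using c unfolding sq by simp
          also have "\<dots> = R" using s by (simp add: R_def)
          finally show ?thesis ..
        qed
        have distr: "x * (u - w) = u * x - w * x" for x u w :: real by (simp add: algebra_simps)
        from \<open>R = (2 * cos t - (-2)) / (sin t / (pi * W t))\<close> have "ln R = ln \<bar>2 * cos t - (-2)\<bar> - ln (sin t / (pi * W t))"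
          using c2 s Wt by (simp only: ln_div) simp
        then have lnR: "c * ln R = l (-2) t - v t"
          by (simp only: l_def v_def c_def distr)
        have "ln ((q t)\<^sup>2 * R) \<le> (q t)\<^sup>2 * R"
          using ln_le_minus_one[of "(q t)\<^sup>2 * R"] R qt by simp
        moreover have "ln ((q t)\<^sup>2 * R) = 2 * ln \<bar>q t\<bar> + ln R"
        proof -
          have "ln ((q t)\<^sup>2) = 2 * ln \<bar>q t\<bar>"
            using ln_realpow[of "\<bar>q t\<bar>" 2] qt by simp
          then show ?thesis using R qt by (simp add: ln_mult)
        qed
        ultimately have "c * (2 * ln \<bar>q t\<bar> + ln R) \<le> c * ((q t)\<^sup>2 * R)"
          using c by (intro mult_left_mono) auto
        also have "c * ((q t)\<^sup>2 * R) = pi * w t" using c by (simp add: R_def w_def)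
        finally show "L t \<le> pi * w t + v t - l (-2) t"
          using L lnR by (simp add: distrib_left)
      qed
    qed
  qed (use L_int w_int v_int l_int in auto)
  also have "\<dots> = pi * (LBINT t:{0..pi}. w t) + (LBINT t:{0..pi}. v t) - (LBINT t:{0..pi}. l (-2) t)"
    using w_int(1) v_int l_int[of "-2"] by simp
  \<comment> \<open>Subtracting this adds \<open>pi\<close>; with the \<open>pi\<close> from the
    moment bound it makes up the constant \<open>2 * pi\<close>.\<close>
  also have "(LBINT t:{0..pi}. l (-2) t) = - pi"
    using log_potential_inside(2)[of "-2"] by (simp add: l_def[abs_def])
  also have "pi * (LBINT t:{0..pi}. w t) \<le> pi * 1"
    using w_int(2) by (intro mult_left_mono) auto
  finally show ?thesis
    unfolding L_int lnA S_def[symmetric] l_def[abs_def] v_def[abs_def] by (simp add: mult.commute mult.left_commute)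
qed


text \<open>Row sums are 2 + O(1 / k), and 1 / k <= 1 / (m + 1) for k > m. The entry
  \<open>a (k - 1)\<close> accounts for \<open>2 * K\<close> because 1 / (k - 1) <= 2 / k for k >=
  2.\<close>

lemma jacobi_rows_bound:
  assumes "(\<lambda>n. real n * (a n - 1)) \<longlonglongrightarrow> \<alpha>" and "(\<lambda>n. real n * b n) \<longlonglongrightarrow> \<beta>"
  shows "\<exists>C\<ge>0. \<forall>m k. k > m \<longrightarrow> b k + a k + (if k = 1 then 0 else a (k - 1)) \<le> 2 + C / real (Suc m)"
proof -
  have "Bseq (\<lambda>n. real n * (a n - 1))" "Bseq (\<lambda>n. real n * b n)"
    using assms by (auto intro: convergent_imp_Bseq convergentI)
  then obtain K M where K: "\<And>n. \<bar>real n * (a n - 1)\<bar> \<le> K" and M: "\<And>n. \<bar>real n * b n\<bar> \<le> M"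
    unfolding Bseq_def real_norm_def by blast
  have K0: "K \<ge> 0" and M0: "M \<ge> 0" using K[of 0] M[of 0] by auto
  have a: "a k \<le> 1 + K / k" if "k \<ge> 1" for k
    using abs_le_D1[OF K[of k]] that by (simp add: field_simps)
  have b: "b k \<le> M / k" if "k \<ge> 1" for k
    using abs_le_D1[OF M[of k]] that by (simp add: field_simps)
  have "b k + a k + (if k = 1 then 0 else a (k - 1)) \<le> 2 + (M + 3 * K) / real (Suc m)" if "k > m" for m k
  proof -
    have k: "k \<ge> 1" using that by simp
    have "(if k = 1 then 0 else a (k - 1)) \<le> 1 + 2 * K / k"
    proof (cases "k = 1")
      case True
      then show ?thesis using K0 by simp
    next
      case False
      then have "a (k - 1) \<le> 1 + K / real (k - 1)" using k by (intro a) auto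
      also have "K / real (k - 1) \<le> 2 * K / k"
      proof -
        have "K * real k \<le> K * (2 * real (k - 1))" using K0 False k by (intro mult_left_mono) auto
        then show ?thesis using False k by (simp add: field_simps)
      qed
      finally show ?thesis using False by simp
    qed
    then have "b k + a k + (if k = 1 then 0 else a (k - 1)) \<le> M / k + (1 + K / k) + (1 + 2 * K / k)"
      using a[OF k] b[OF k] by linarith
    also have "\<dots> = 2 + (M + 3 * K) / k" by (simp add: add_divide_distrib)
    also have "(M + 3 * K) / k \<le> (M + 3 * K) / real (Suc m)"
      using that K0 M0 by (intro divide_left_mono) auto
    finally show ?thesis by simp
  qed
  then show ?thesis using K0 M0 by (intro exI[of _ "M + 3 * K"]) auto
qed

lemma szego_failure_circle:
  fixes a b :: "nat \<Rightarrow> real" and W :: "real \<Rightarrow> real"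
  assumes pos: "\<And>n. n \<ge> 1 \<Longrightarrow> a n > 0"
    and a: "(\<lambda>n. real n * (a n - 1)) \<longlonglongrightarrow> \<alpha>" and b: "(\<lambda>n. real n * b n) \<longlonglongrightarrow> \<beta>"
    and gap: "\<beta> > 2 * \<alpha>"
    and W: "W \<in> borel_measurable borel" "\<And>t. W t \<ge> 0"
    and Wpos: "AE t\<in>{0..pi} in lborel. W t > 0"
    and Wint: "set_integrable lborel {0..pi} (\<lambda>t. ln (sin t / (pi * W t)))"
    and bound: "\<And>n. (\<integral>\<^sup>+t\<in>{0..pi}. ennreal ((poly (orthpoly a b n) (2 * cos t))\<^sup>2 * (W t * (2 * sin t))) \<partial>lborel) \<le> 1"
  shows False
proof -
  obtain C where C: "C \<ge> 0" "\<And>m k. k > m \<Longrightarrow> b k + a k + (if k = 1 then 0 else a (k - 1)) \<le> 2 + C / real (Suc m)"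
    using jacobi_rows_bound[OF a b] by blast
  obtain D where D: "D \<ge> 0" "\<And>x. pi * x / 2 - D * max 0 (x - 2) powr (5 / 4)
      \<le> (LBINT t:{0..pi}. ln \<bar>2 * cos t - x\<bar> * (1 - cos t))"
    using log_potential_lower by blast
  define Q where "Q = (\<Sum>m. (C / real (Suc m)) powr (5 / 4))"
  have summ: "summable (\<lambda>m. (C / real (Suc m)) powr (5 / 4))"
  proof -
    have "summable (\<lambda>m. real m powr (- (5 / 4)))" by (subst summable_real_powr_iff) simp
    then have "summable (\<lambda>m. real (Suc m) powr (- (5 / 4)))" by (subst summable_Suc_iff)
    then have "summable (\<lambda>m. C powr (5 / 4) * real (Suc m) powr (- (5 / 4)))" by (rule summable_mult)
    then show ?thesis using C(1) by (simp add: powr_divide powr_minus_divide)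
  qed
  define K where "K = 2 * pi + (LBINT t:{0..pi}. ln (sin t / (pi * W t)) * (1 - cos t)) + 2 * D * Q"
  have upper: "pi * (\<Sum>k=1..n. b k - 2 * (a k - 1)) \<le> K" for n
  proof -
    define S where "S = {x. poly (orthpoly a b n) x = 0}"
    note fac = orthpoly_factorization[where a = a and b = b and n = n, OF pos, folded S_def]
    have fin: "finite S" using fac(1) by simp
    have "(\<Sum>s\<in>S. max 0 (s - 2) powr (5 / 4)) \<le> (\<Sum>m<card S. max 0 ((2 + C / real (Suc m)) - 2) powr (5 / 4))"
    proof (rule sum_le_of_card_greater[OF fin])
      fix m
      have "card {x. poly (orthpoly a b n) x = 0 \<and> x > 2 + C / real (Suc m)} \<le> m"
        using C(2) by (intro card_orthpoly_roots_greater pos) auto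
      then show "card {s \<in> S. 2 + C / real (Suc m) < s} \<le> m" by (simp add: S_def)
    qed (auto intro!: powr_mono2)
    also have "\<dots> = (\<Sum>m<card S. (C / real (Suc m)) powr (5 / 4))"
      using C(1) by (intro sum.cong refl) (simp add: max_def)
    also have "\<dots> \<le> Q" unfolding Q_def by (rule sum_le_suminf[OF summ]) auto
    finally have Q: "(\<Sum>s\<in>S. max 0 (s - 2) powr (5 / 4)) \<le> Q" .
    have "pi * (\<Sum>k=1..n. b k) - 2 * D * Q \<le> pi * (\<Sum>s\<in>S. s) - 2 * D * (\<Sum>s\<in>S. max 0 (s - 2) powr (5 / 4))"
      using mult_left_mono[OF Q D(1)] fac(3) by simp
    also have "\<dots> = 2 * (\<Sum>s\<in>S. pi * s / 2 - D * max 0 (s - 2) powr (5 / 4))"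
      by (simp add: sum_subtractf sum_distrib_left[symmetric] sum_divide_distrib[symmetric] right_diff_distrib)
    also have "\<dots> \<le> 2 * (\<Sum>s\<in>S. (LBINT t:{0..pi}. ln \<bar>2 * cos t - s\<bar> * (1 - cos t)))"
      by (intro mult_left_mono sum_mono D(2)) auto
    also have "\<dots> \<le> 2 * pi * (\<Sum>k=1..n. ln (a k)) + 2 * pi + (LBINT t:{0..pi}. ln (sin t / (pi * W t)) * (1 - cos t))"
      unfolding S_def by (rule sum_log_potential_le[OF pos W Wpos Wint bound])
    finally have "pi * (\<Sum>k=1..n. b k) - 2 * pi * (\<Sum>k=1..n. ln (a k)) \<le> K"
      by (simp add: K_def)
    \<comment> \<open>The logarithms stand on the upper side of the estimate, so they may be
      linearized; what remains is linear in the sequences with known limits.\<close>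
    moreover have "(\<Sum>k=1..n. ln (a k)) \<le> (\<Sum>k=1..n. a k - 1)"
      by (intro sum_mono ln_le_minus_one pos) auto
    then have "2 * pi * (\<Sum>k=1..n. ln (a k)) \<le> 2 * pi * (\<Sum>k=1..n. a k - 1)"
      by (intro mult_left_mono) auto
    ultimately show ?thesis
      by (simp add: sum_subtractf right_diff_distrib sum_distrib_left[symmetric])
  qed
  \<comment> \<open>Half the limit of k (b_k - 2 (a_k - 1)), so that this quantity eventually
    exceeds \<open>d\<close>.\<close>
  define d where "d = (\<beta> - 2 * \<alpha>) / 2"
  have d: "d > 0" using gap by (simp add: d_def)
  define y where "y k = b k - 2 * (a k - 1) - d / real k" for k
  have "(\<lambda>k. real k * b k - 2 * (real k * (a k - 1))) \<longlonglongrightarrow> \<beta> - 2 * \<alpha>"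
    by (intro tendsto_diff tendsto_mult a b tendsto_const)
  then have "\<forall>\<^sub>F k in sequentially. real k * b k - 2 * (real k * (a k - 1)) > d"
    by (rule order_tendstoD) (use d in \<open>simp add: d_def\<close>)
  then obtain N where N: "\<And>k. k \<ge> N \<Longrightarrow> real k * b k - 2 * (real k * (a k - 1)) > d"
    by (auto simp: eventually_sequentially)
  have ynn: "y k \<ge> 0" if "k \<ge> N" "k \<ge> 1" for k
  proof -
    have "d / real k \<le> (real k * b k - 2 * (real k * (a k - 1))) / real k"
      using N[OF that(1)] that(2) by (intro divide_right_mono) auto
    also have "\<dots> = b k - 2 * (a k - 1)" using that(2) by (simp add: field_simps)
    finally show ?thesis by (simp add: y_def)
  qed
  \<comment> \<open>Absorbs the finitely many indices at which \<open>y k\<close> may be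
    negative.\<close>
  define B where "B = (\<Sum>k=1..N. \<bar>y k\<bar>)"
  have lower: "- B \<le> (\<Sum>k=1..n. y k)" for n
  proof -
    have "- B \<le> - (\<Sum>k\<in>{1..n} \<inter> {..N}. \<bar>y k\<bar>)"
      unfolding B_def by (simp, intro sum_mono2) auto
    also have "\<dots> = (\<Sum>k=1..n. if k \<le> N then - \<bar>y k\<bar> else 0)"
      by (simp add: sum.If_cases sum_negf atMost_def)
    also have "\<dots> \<le> (\<Sum>k=1..n. y k)"
      using ynn by (intro sum_mono) (auto simp: not_le)
    finally show ?thesis .
  qed
  have "harm n \<le> (K / pi + B) / d" for n
  proof -
    have "pi * (\<Sum>k=1..n. b k - 2 * (a k - 1)) / pi \<le> K / pi"
      using upper[of n] by (rule divide_right_mono) simp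
    then have "(\<Sum>k=1..n. b k - 2 * (a k - 1)) \<le> K / pi" by simp
    moreover have "(\<Sum>k=1..n. b k - 2 * (a k - 1)) = (\<Sum>k=1..n. y k) + d * harm n"
      by (simp add: y_def harm_def sum_subtractf sum_distrib_left inverse_eq_divide)
    ultimately have "d * harm n \<le> K / pi + B" using lower[of n] by linarith
    then show ?thesis using d by (simp add: field_simps)
  qed
  moreover obtain n where "(K / pi + B) / d < harm n"
  proof -
    have "\<forall>\<^sub>F n in sequentially. (K / pi + B) / d < harm n"
      using harm_at_top by (auto simp: filterlim_at_top_dense)
    then show ?thesis using that by (auto simp: eventually_sequentially)
  qed
  ultimately show False using not_le by blast
qed

text \<open>The value \<open>\<infinity>\<close> where \<open>w\<close> vanishes makes positivity almost everywhere part of the finiteness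
  of the integral.\<close>

definition szego_abs :: "(real \<Rightarrow> real) \<Rightarrow> real \<Rightarrow> ennreal" where
  "szego_abs w E = (if w E \<le> 0 then \<infinity> else ennreal \<bar>ln (sqrt (4 - E\<^sup>2) / (2 * pi * w E)) / sqrt (4 - E\<^sup>2)\<bar>)"

lemma szego_abs_measurable [measurable]:
  assumes [measurable]: "w \<in> borel_measurable borel"
  shows "szego_abs w \<in> borel_measurable borel"
proof -
  have [measurable]: "(\<lambda>E::real. sqrt (4 - E\<^sup>2)) \<in> borel_measurable borel"
    by (intro borel_measurable_continuous_onI continuous_intros)
  show ?thesis unfolding szego_abs_def[abs_def] by measurable
qed

section \<open>From the interval to the circle and the final contradiction\<close>

text \<open>Under E = 2 cos t the measure dE / sqrt (4 - E^2) becomes dt on [0, \<pi>] and the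
  logarithm becomes ln (sin t / (\<pi> W t)), so \<open>fin\<close> yields its Lebesgue
  integrability.\<close>

lemma szego_failure_interval:
  fixes a b :: "nat \<Rightarrow> real" and w :: "real \<Rightarrow> real"
  assumes pos: "\<And>n. n \<ge> 1 \<Longrightarrow> a n > 0"
    and a: "(\<lambda>n. real n * (a n - 1)) \<longlonglongrightarrow> \<alpha>" and b: "(\<lambda>n. real n * b n) \<longlonglongrightarrow> \<beta>"
    and gap: "\<beta> > 2 * \<alpha>"
    and w [measurable]: "w \<in> borel_measurable borel" and w0: "\<And>E. w E \<ge> 0"
    and fin: "(\<integral>\<^sup>+E\<in>{-2<..<2}. szego_abs w E \<partial>lborel) < \<infinity>"
    and bound: "\<And>n. (\<integral>\<^sup>+E\<in>{-2<..<2}. ennreal ((poly (orthpoly a b n) E)\<^sup>2 * w E) \<partial>lborel) \<le> 1"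
  shows False
proof -
  define W where "W t = w (2 * cos t)" for t
  have W [measurable]: "W \<in> borel_measurable borel" unfolding W_def[abs_def] by measurable
  define F where "F t = szego_abs w (2 * cos t) * ennreal (2 * sin t)" for t
  have F [measurable]: "F \<in> borel_measurable borel" unfolding F_def[abs_def] by measurable
  have F_int: "(\<integral>\<^sup>+t\<in>{0..pi}. F t \<partial>lborel) < \<infinity>"
    using fin nn_integral_cos_substitution[of "szego_abs w"] by (simp add: F_def)
  have sqrt_sin: "sqrt (4 - (2 * cos t)\<^sup>2) = 2 * sin t" if "t \<in> {0..pi}" for t
  proof -
    have "4 - (2 * cos t)\<^sup>2 = (2 * sin t)\<^sup>2" by (simp add: power_mult_distrib sin_squared_eq)
    moreover have "sin t \<ge> 0" using that by (intro sin_ge_zero) auto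
    ultimately show ?thesis by (simp only: real_sqrt_abs)
  qed
  have "AE t in lborel. F t * indicator {0..pi} t \<noteq> \<infinity>"
    using F_int by (intro nn_integral_PInf_AE) auto
  then have AE: "AE t\<in>{0..pi} in lborel. W t > 0 \<and> sin t > 0"
    using AE_lborel_singleton[of "0::real"] AE_lborel_singleton[of pi]
  proof eventually_elim
    case (elim t)
    show ?case
    proof
      assume t: "t \<in> {0..pi}"
      then have s: "sin t > 0" using elim by (intro sin_gt_zero) auto
      moreover have "W t > 0"
      proof (rule ccontr)
        assume "\<not> W t > 0"
        then have "szego_abs w (2 * cos t) = \<infinity>" by (simp add: szego_abs_def W_def)
        then have "F t = \<infinity>" using s by (simp add: F_def ennreal_top_mult)
        then show False using elim t by simp
      qed
      ultimately show "W t > 0 \<and> sin t > 0" by simp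
    qed
  qed
  define g where "g t = ln (sin t / (pi * W t))" for t
  have g [measurable]: "g \<in> borel_measurable borel" unfolding g_def[abs_def] by measurable
  have "set_integrable lborel {0..pi} g"
    unfolding set_integrable_def
  proof (rule integrableI_bounded)
    have "(\<integral>\<^sup>+t. ennreal (norm (indicator {0..pi} t *\<^sub>R g t)) \<partial>lborel) = (\<integral>\<^sup>+t\<in>{0..pi}. F t \<partial>lborel)"
    proof (rule nn_integral_cong_AE)
      show "AE t in lborel. ennreal (norm (indicator {0..pi} t *\<^sub>R g t)) = F t * indicator {0..pi} t"
        using AE
      proof eventually_elim
        case (elim t)
        show ?case
        proof (cases "t \<in> {0..pi}")
          case True
          then have s: "sin t > 0" and Wt: "W t > 0" using elim by auto
          have "F t = ennreal (\<bar>ln (2 * sin t / (2 * pi * W t)) / (2 * sin t)\<bar>) * ennreal (2 * sin t)"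
          proof -
            have "\<not> w (2 * cos t) \<le> 0" using Wt by (simp add: W_def)
            then show ?thesis by (simp only: F_def szego_abs_def sqrt_sin[OF True] W_def if_False)
          qed
          also have "\<dots> = ennreal (\<bar>ln (2 * sin t / (2 * pi * W t)) / (2 * sin t)\<bar> * (2 * sin t))"
            using s by (intro ennreal_mult[symmetric]) auto
          also have "\<bar>ln (2 * sin t / (2 * pi * W t)) / (2 * sin t)\<bar> * (2 * sin t) = \<bar>g t\<bar>"
            using s by (simp add: g_def abs_divide)
          finally show ?thesis using True by simp
        qed simp
      qed
    qed
    then show "(\<integral>\<^sup>+t. ennreal (norm (indicator {0..pi} t *\<^sub>R g t)) \<partial>lborel) < \<infinity>" using F_int by simp
  qed simp
  moreover have "(\<integral>\<^sup>+t\<in>{0..pi}. ennreal ((poly (orthpoly a b n) (2 * cos t))\<^sup>2 * (W t * (2 * sin t))) \<partial>lborel) \<le> 1" for n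
  proof -
    have "(\<lambda>E. poly (orthpoly a b n) E) \<in> borel_measurable borel"
      by (intro borel_measurable_continuous_onI continuous_intros)
    then have [measurable]: "(\<lambda>E. ennreal ((poly (orthpoly a b n) E)\<^sup>2 * w E)) \<in> borel_measurable borel"
      by measurable
    have "(\<integral>\<^sup>+t\<in>{0..pi}. ennreal ((poly (orthpoly a b n) (2 * cos t))\<^sup>2 * (W t * (2 * sin t))) \<partial>lborel)
       = (\<integral>\<^sup>+t\<in>{0..pi}. ennreal ((poly (orthpoly a b n) (2 * cos t))\<^sup>2 * w (2 * cos t)) * ennreal (2 * sin t) \<partial>lborel)"
      using w0 by (intro nn_integral_cong)
        (auto simp: W_def indicator_def ennreal_mult[symmetric] sin_ge_zero mult.assoc)
    also have "\<dots> = (\<integral>\<^sup>+E\<in>{-2<..<2}. ennreal ((poly (orthpoly a b n) E)\<^sup>2 * w E) \<partial>lborel)"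
      by (rule nn_integral_cos_substitution[symmetric]) measurable
    finally show ?thesis using bound[of n] by simp
  qed
  moreover have "AE t\<in>{0..pi} in lborel. W t > 0" using AE by (auto elim!: eventually_mono)
  moreover have "W t \<ge> 0" for t using w0 by (simp add: W_def)
  ultimately show False
    using szego_failure_circle[OF pos a b gap W, unfolded g_def[symmetric]] unfolding g_def by blast
qed

theorem theorem3:
  fixes a b :: "nat \<Rightarrow> real" and \<alpha> \<beta> :: real and \<nu> :: "real measure"
  assumes "\<And>n. n \<ge> 1 \<Longrightarrow> a n > 0"
    and "(\<lambda>n. real n * (a n - 1)) \<longlonglongrightarrow> \<alpha>"
    and "(\<lambda>n. real n * b n) \<longlonglongrightarrow> \<beta>"
    and "\<bar>\<beta>\<bar> > 2 * \<alpha>"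
    and "is_spectral_measure (jacobi_op a b) (delta 1) \<nu>"
  shows "szego_integral \<nu> = \<infinity>"
proof -
  note pos = assms(1)
  have fin: "finite_measure \<nu>" and sets: "sets \<nu> = sets borel"
    using assms(5) by (auto simp: is_spectral_measure_def)
  obtain K where K: "\<And>n. n \<ge> 1 \<Longrightarrow> \<bar>a n\<bar> \<le> K" "\<And>n. n \<ge> 1 \<Longrightarrow> \<bar>b n\<bar> \<le> K"
  proof -
    have "Bseq (\<lambda>n. real n * (a n - 1))" "Bseq (\<lambda>n. real n * b n)"
      using assms(2,3) by (auto intro: convergent_imp_Bseq convergentI)
    then obtain M N where M: "\<And>n. \<bar>real n * (a n - 1)\<bar> \<le> M" and N: "\<And>n. \<bar>real n * b n\<bar> \<le> N"
      unfolding Bseq_def real_norm_def by blast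
    have le: "\<bar>x\<bar> \<le> \<bar>real n * x\<bar>" if "n \<ge> 1" for n :: nat and x
      using mult_right_mono[of 1 "real n" "\<bar>x\<bar>"] that by (simp add: abs_mult)
    have "\<bar>a n\<bar> \<le> 1 + M + N" "\<bar>b n\<bar> \<le> 1 + M + N" if "n \<ge> 1" for n
      using le[OF that, of "a n - 1"] le[OF that, of "b n"] M[of n] N[of n] by linarith+
    then show thesis by (rule that)
  qed
  define \<rho> where "\<rho> = ac_density \<nu>"
  define w where "w E = enn2real (\<rho> E)" for E
  have [measurable]: "\<rho> \<in> borel_measurable borel"
    using borel_measurable_RN_deriv[of lborel "ac_part \<nu>"] by (simp add: \<rho>_def ac_density_def)
  have w [measurable]: "w \<in> borel_measurable borel" unfolding w_def[abs_def] by measurable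
  obtain \<sigma> where ac: "sets (ac_part \<nu>) = sets borel" "absolutely_continuous lborel (ac_part \<nu>)"
    and dec: "\<And>B. B \<in> sets borel \<Longrightarrow> emeasure \<nu> B = emeasure (ac_part \<nu>) B + emeasure \<sigma> B"
    using is_ac_part_ac_part[OF fin sets] unfolding is_ac_part_def by blast
  have dens: "density lborel \<rho> = ac_part \<nu>"
    unfolding \<rho>_def ac_density_def
    by (rule sigma_finite_measure.density_RN_deriv[OF sigma_finite_lborel]) (use ac in auto)
  have "emeasure (ac_part \<nu>) B \<le> emeasure \<nu> B" for B
    by (cases "B \<in> sets borel") (simp_all add: dec ac(1) sets emeasure_notin_sets)
  then have le: "ac_part \<nu> \<le> \<nu>"
    unfolding le_measure_iff using ac(1) sets sets_eq_imp_space_eq[of "ac_part \<nu>" \<nu>]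
    by (auto simp: le_fun_def)
  \<comment> \<open>Dropping the singular part turns the exact moments of \<open>\<nu>\<close> into
    upper bounds for those of its density.\<close>
  have nn_le: "(\<integral>\<^sup>+E. f E * \<rho> E \<partial>lborel) \<le> (\<integral>\<^sup>+E. f E \<partial>\<nu>)" if [measurable]: "f \<in> borel_measurable borel" for f
  proof -
    have "(\<integral>\<^sup>+E. f E * \<rho> E \<partial>lborel) = (\<integral>\<^sup>+E. f E \<partial>ac_part \<nu>)"
      unfolding dens[symmetric] by (simp add: nn_integral_density mult.commute)
    also have "\<dots> \<le> (\<integral>\<^sup>+E. f E \<partial>\<nu>)"
      using le ac(1) sets by (intro nn_integral_mono_measure) auto
    finally show ?thesis .
  qed
  \<comment> \<open>\<open>enn2real\<close> sends \<open>\<infinity>\<close> to \<open>0\<close>, so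
    \<open>w\<close> represents the density only where \<open>\<rho>\<close> is finite.\<close>
  have \<rho>_fin: "AE E in lborel. \<rho> E \<noteq> \<infinity>"
  proof (rule nn_integral_PInf_AE)
    have "(\<integral>\<^sup>+E. \<rho> E \<partial>lborel) \<le> emeasure \<nu> (space \<nu>)" using nn_le[of "\<lambda>_. 1"] by simp
    then show "(\<integral>\<^sup>+E. \<rho> E \<partial>lborel) \<noteq> \<infinity>"
      using finite_measure.finite_emeasure_space[OF fin] by (auto simp: top_unique)
  qed simp
  have moments: "(\<integral>\<^sup>+E\<in>{-2<..<2}. ennreal ((poly (orthpoly a b n) E)\<^sup>2 * w E) \<partial>lborel) \<le> 1" for n
  proof -
    have "(\<lambda>E. poly (orthpoly a b n) E) \<in> borel_measurable borel"
      by (intro borel_measurable_continuous_onI continuous_intros)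
    then have [measurable]: "(\<lambda>E. ennreal ((poly (orthpoly a b n) E)\<^sup>2)) \<in> borel_measurable borel"
      by measurable
    have "(\<integral>\<^sup>+E\<in>{-2<..<2}. ennreal ((poly (orthpoly a b n) E)\<^sup>2 * w E) \<partial>lborel)
        \<le> (\<integral>\<^sup>+E. ennreal ((poly (orthpoly a b n) E)\<^sup>2) * \<rho> E \<partial>lborel)"
      using \<rho>_fin by (intro nn_integral_mono_AE)
        (auto elim!: eventually_mono simp: w_def ennreal_mult indicator_def top.not_eq_extremum)
    also have "\<dots> \<le> (\<integral>\<^sup>+E. ennreal ((poly (orthpoly a b n) E)\<^sup>2) \<partial>\<nu>)"
      by (rule nn_le) measurable
    also have "\<dots> = 1"
      by (rule nn_integral_orthpoly_square[OF pos K assms(5)])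
    finally show ?thesis .
  qed
  define P N where "P = (\<integral>\<^sup>+E\<in>{-2<..<2}. e2ennreal (szego_integrand \<nu> E) \<partial>lborel)"
    and "N = (\<integral>\<^sup>+E\<in>{-2<..<2}. e2ennreal (- szego_integrand \<nu> E) \<partial>lborel)"
  have N: "N < \<infinity>" unfolding N_def by (rule szego_integral_negative_part_finite[OF fin sets])
  \<comment> \<open>With \<open>N\<close> finite, a finite \<open>P\<close> would bound the integral
    of the absolute value.\<close>
  have "P = \<infinity>"
  proof (rule ccontr)
    assume P: "P \<noteq> \<infinity>"
    have [measurable]: "(\<lambda>E::real. sqrt (4 - E\<^sup>2)) \<in> borel_measurable borel"
      by (intro borel_measurable_continuous_onI continuous_intros)
    have [measurable]: "szego_integrand \<nu> \<in> borel_measurable borel"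
      unfolding szego_integrand_def[abs_def] \<rho>_def[symmetric] by measurable
    have "(\<integral>\<^sup>+E\<in>{-2<..<2}. szego_abs w E \<partial>lborel)
        \<le> (\<integral>\<^sup>+E. e2ennreal (szego_integrand \<nu> E) * indicator {-2<..<2} E
            + e2ennreal (- szego_integrand \<nu> E) * indicator {-2<..<2} E \<partial>lborel)"
    proof (rule nn_integral_mono_AE)
      show "AE E in lborel. szego_abs w E * indicator {-2<..<2} E
          \<le> e2ennreal (szego_integrand \<nu> E) * indicator {-2<..<2} E
            + e2ennreal (- szego_integrand \<nu> E) * indicator {-2<..<2} E"
        using \<rho>_fin
      proof eventually_elim
        case (elim E)
        show ?case
        proof (cases "\<rho> E = 0")
          case True
          then show ?thesis by (simp add: szego_integrand_def \<rho>_def[symmetric] indicator_def e2ennreal_infty)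
        next
          case False
          then have "w E > 0" using elim by (simp add: w_def enn2real_positive_iff top.not_eq_extremum zero_less_iff_neq_zero)
          define G where "G = ln (sqrt (4 - E\<^sup>2) / (2 * pi * w E)) / sqrt (4 - E\<^sup>2)"
          have "szego_integrand \<nu> E = ereal G"
            using False by (simp add: szego_integrand_def \<rho>_def[symmetric] G_def w_def)
          moreover have "szego_abs w E = ennreal \<bar>G\<bar>"
            using \<open>w E > 0\<close> by (simp add: szego_abs_def G_def)
          moreover have "ennreal \<bar>G\<bar> \<le> ennreal G + ennreal (- G)"
            by (cases "G \<ge> 0") (simp_all add: ennreal_neg)
          ultimately show ?thesis by (simp add: e2ennreal_ereal indicator_def)
        qed
      qed
    qed
    also have "\<dots> = P + N" unfolding P_def N_def by (rule nn_integral_add) measurable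
    also have "\<dots> < \<infinity>" using P N by (simp add: top.not_eq_extremum)
    finally have szego: "(\<integral>\<^sup>+E\<in>{-2<..<2}. szego_abs w E \<partial>lborel) < \<infinity>" .
    have w0: "w E \<ge> 0" for E by (simp add: w_def)
    show False
    proof (cases "\<beta> \<ge> 0")
      case True
      then have gap: "\<beta> > 2 * \<alpha>" using assms(4) by simp
      show False by (rule szego_failure_interval[OF pos assms(2,3) gap w w0 szego moments])
    next
      case False
      \<comment> \<open>Negating \<open>b\<close> reflects the density. The Szego integrand is even
        in E apart from the density, and the polynomials change by a reflection and a sign that
        squaring removes, so all hypotheses carry over.\<close>
      then have gap: "- \<beta> > 2 * \<alpha>" using assms(4) by simp
      have b': "(\<lambda>n. real n * - b n) \<longlonglongrightarrow> - \<beta>" using tendsto_minus[OF assms(3)] by simp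
      have w' [measurable]: "(\<lambda>E. w (- E)) \<in> borel_measurable borel" by measurable
      have reflected: "szego_abs (\<lambda>E. w (- E)) E = szego_abs w (- E)" for E
        by (simp add: szego_abs_def)
      have szego': "(\<integral>\<^sup>+E\<in>{-2<..<2}. szego_abs (\<lambda>E. w (- E)) E \<partial>lborel) < \<infinity>"
        using szego nn_integral_reflect[of "szego_abs w" 2] by (simp add: reflected)
      have moments': "(\<integral>\<^sup>+E\<in>{-2<..<2}. ennreal ((poly (orthpoly a (\<lambda>k. - b k) n) E)\<^sup>2 * w (- E)) \<partial>lborel) \<le> 1" for n
      proof -
        have "(\<lambda>E. poly (orthpoly a b n) E) \<in> borel_measurable borel"
          by (intro borel_measurable_continuous_onI continuous_intros)
        then have [measurable]: "(\<lambda>E. ennreal ((poly (orthpoly a b n) E)\<^sup>2 * w E)) \<in> borel_measurable borel"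
          by measurable
        show ?thesis
          using moments[of n] nn_integral_reflect[of "\<lambda>E. ennreal ((poly (orthpoly a b n) E)\<^sup>2 * w E)" 2]
          by (simp add: orthpoly_reflect power_mult_distrib power_mult[symmetric] mult.commute[of n 2] del: power_mult)
      qed
      have w0': "w (- E) \<ge> 0" for E by (rule w0)
      show False by (rule szego_failure_interval[OF pos assms(2) b' gap w' w0' szego' moments'])
    qed
  qed
  then show ?thesis
    using N unfolding szego_integral_def P_def[symmetric] N_def[symmetric]
    by (cases N) (simp_all add: top_ennreal.rep_eq)
qed

end
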